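(* Inverse semirings precisely correspond to idempotent semirings $Q$ equipped with a lax monoidal functor $F\colon Q\to\mathbf{Ab}$. Inverse semiring homomorphisms, from the inverse semiring corresponding to $(Q,F)$ to that corresponding to $(Q',F')$, correspond to pairs $(f,\alpha)$ where $f\colon Q\to Q'$ is a semiring homomorphism between the respective idempotent semirings and $\alpha\colon F\to F'\circ f$ is a natural transformation living in the functor category $\mathbf{Cat}(Q,\mathbf{Ab})$. Given such a functor $F$, the associated inverse semiring consists of elements $(e,g)$ with $e\in Q$ and $g\in F(e)$. The addition is given by \[(e_1,g_1)+(e_2,g_2)=\bigl(e_1\vee e_2,\;F(e_1\le e_1\vee e_2)(g_1)+F(e_2\le e_1\vee e_2)(g_2)\bigr),\] with additive identity $(0,0)$. Let $\mu_{X,Y}\colon F(X)\otimes F(Y)\to F(X\otimes Y)$ be the associated multiplication structure map of $F$. Then the multiplication is given by \[(e_1,g_1)(e_2,g_2)=(e_1e_2,\;\mu(g_1\otimes g_2)),\] with multiplicative identity $(1,\iota(1))$, where $\iota\colon\mathbb{Z}\to F(1)$ is the unit structure map of $F$, the $1$ in the first component is the multiplicative unit of $Q$, and the $1$ in the second component is the integer $1\in\mathbb{Z}$.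
   Context: A commutative inverse monoid is a commutative monoid $(M,+,0)$ in which each $x$ has a unique $x^*$ with $x+x^*+x=x$ and $x^*+x+x^*=x^*$. An inverse semiring is a semiring (with $0$ and $1$, multiplication not assumed commutative) whose additive structure is a commutative inverse monoid; equivalently, a monoid in the category of commutative inverse monoids with respect to the tensor product. Semiring homomorphisms preserve $0$ and $1$. An idempotent semiring is a semiring in which $x+x=x$ for all $x$, equivalently a monoid in the category of semilattices with respect to the tensor product. Its additive structure is regarded as a join-semilattice with $\vee=+$ and bottom element $0$, ordered by $e\le e'$ if and only if $e\vee e'=e'$. An idempotent semiring $Q$ is viewed as a strict monoidal category: the underlying category is the poset $(Q,\le)$, the tensor product $X\otimes Y$ is the product $XY$ in $Q$, and the unit is $1\in Q$. $\mathbf{Ab}$ is the category of abelian groups with its usual tensor product and unit $\mathbb{Z}$. $\mathbf{Cat}(Q,\mathbf{Ab})$ is the category of functors from $Q$ to $\mathbf{Ab}$ and natural transformations between them. A lax monoidal functor $F\colon Q\to\mathbf{Ab}$ is a functor with a morphism $\iota\colon\mathbb{Z}\to F(1)$ and a natural transformation $\mu_{X,Y}\colon F(X)\otimes F(Y)\to F(X\otimes Y)$ satisfying the usual associativity and unit coherence conditions.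
   Formalization: The natural transformation α is required to be monoidal (compatible with ι and μ); for arbitrary natural transformations the claim fails, e.g. for trivial Q and F=F'=ℤ, where all additive maps ℤ→ℤ are natural but only one is a unital ring homomorphism. *)

theory Defs
  imports "HOL-Algebra.Ring" "HOL-Algebra.Free_Abelian_Groups"
begin

section \<open>Inverse semirings and idempotent semirings\<close>

definition comm_inverse_monoid :: "('a, 'm) monoid_scheme \<Rightarrow> bool" where
  "comm_inverse_monoid M \<longleftrightarrow> comm_monoid M \<and>
    (\<forall>x\<in>carrier M. \<exists>!y. y \<in> carrier M \<and>
       x \<otimes>\<^bsub>M\<^esub> y \<otimes>\<^bsub>M\<^esub> x = x \<and> y \<otimes>\<^bsub>M\<^esub> x \<otimes>\<^bsub>M\<^esub> y = y)"

definition inverse_semiring :: "('a, 'm) ring_scheme \<Rightarrow> bool" where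
  "inverse_semiring R \<longleftrightarrow> semiring R \<and> comm_inverse_monoid (add_monoid R)"

definition idem_semiring :: "('a, 'm) ring_scheme \<Rightarrow> bool" where
  "idem_semiring Q \<longleftrightarrow> semiring Q \<and> (\<forall>x\<in>carrier Q. x \<oplus>\<^bsub>Q\<^esub> x = x)"

definition idem_le :: "('a, 'm) ring_scheme \<Rightarrow> 'a \<Rightarrow> 'a \<Rightarrow> bool" where
  "idem_le Q e e' \<longleftrightarrow> e \<in> carrier Q \<and> e' \<in> carrier Q \<and> e \<oplus>\<^bsub>Q\<^esub> e' = e'"

text \<open>\<^const>\<open>ring_hom\<close> does not require preservation of zero, which is not automatic for semirings.
  Morphisms are extensional functions, so that equality of morphisms is equality on the carrier.\<close>

definition semiring_homs :: "('a, 'm) ring_scheme \<Rightarrow> ('b, 'n) ring_scheme \<Rightarrow> ('a \<Rightarrow> 'b) set" where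
  "semiring_homs R S = {h \<in> ring_hom R S. h \<zero>\<^bsub>R\<^esub> = \<zero>\<^bsub>S\<^esub> \<and> h \<in> extensional (carrier R)}"

definition semiring_isomorphic :: "('a, 'm) ring_scheme \<Rightarrow> ('b, 'n) ring_scheme \<Rightarrow> bool" where
  "semiring_isomorphic R S \<longleftrightarrow> (\<exists>h\<in>semiring_homs R S. bij_betw h (carrier R) (carrier S))"


section \<open>Tensor products of abelian groups\<close>

text \<open>Abelian groups are \<^const>\<open>comm_group\<close>s, hence written multiplicatively: the group
  operation is \<open>\<otimes>\<close> and the neutral element is \<open>\<one>\<close>.\<close>

definition tensor_relators ::
  "('a, 'm) monoid_scheme \<Rightarrow> ('b, 'n) monoid_scheme \<Rightarrow> ('a \<times> 'b \<Rightarrow>\<^sub>0 int) set" where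
  "tensor_relators A B =
     {frag_of (a \<otimes>\<^bsub>A\<^esub> a', b) - frag_of (a, b) - frag_of (a', b) | a a' b.
        a \<in> carrier A \<and> a' \<in> carrier A \<and> b \<in> carrier B} \<union>
     {frag_of (a, b \<otimes>\<^bsub>B\<^esub> b') - frag_of (a, b) - frag_of (a, b') | a b b'.
        a \<in> carrier A \<and> b \<in> carrier B \<and> b' \<in> carrier B}"

definition tensor_kernel ::
  "('a, 'm) monoid_scheme \<Rightarrow> ('b, 'n) monoid_scheme \<Rightarrow> ('a \<times> 'b \<Rightarrow>\<^sub>0 int) set" where
  "tensor_kernel A B =
     generate (free_Abelian_group (carrier A \<times> carrier B)) (tensor_relators A B)"

definition tensor ::
  "('a, 'm) monoid_scheme \<Rightarrow> ('b, 'n) monoid_scheme \<Rightarrow> ('a \<times> 'b \<Rightarrow>\<^sub>0 int) set monoid" where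
  "tensor A B = free_Abelian_group (carrier A \<times> carrier B) Mod tensor_kernel A B"

definition pure_tensor ::
  "('a, 'm) monoid_scheme \<Rightarrow> ('b, 'n) monoid_scheme \<Rightarrow> 'a \<Rightarrow> 'b \<Rightarrow> ('a \<times> 'b \<Rightarrow>\<^sub>0 int) set" where
  "pure_tensor A B a b =
     tensor_kernel A B #>\<^bsub>free_Abelian_group (carrier A \<times> carrier B)\<^esub> frag_of (a, b)"

definition biadditive :: "('a, 'm) monoid_scheme \<Rightarrow> ('b, 'n) monoid_scheme \<Rightarrow> ('c, 'k) monoid_scheme
    \<Rightarrow> ('a \<Rightarrow> 'b \<Rightarrow> 'c) \<Rightarrow> bool" where
  "biadditive A B C \<beta> \<longleftrightarrow>
     (\<forall>a\<in>carrier A. \<beta> a \<in> hom B C) \<and> (\<forall>b\<in>carrier B. (\<lambda>a. \<beta> a b) \<in> hom A C)"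

definition tensor_lift :: "('a, 'm) monoid_scheme \<Rightarrow> ('b, 'n) monoid_scheme \<Rightarrow> ('c, 'k) monoid_scheme
    \<Rightarrow> ('a \<Rightarrow> 'b \<Rightarrow> 'c) \<Rightarrow> ('a \<times> 'b \<Rightarrow>\<^sub>0 int) set \<Rightarrow> 'c" where
  "tensor_lift A B C \<beta> =
     (THE h. h \<in> hom (tensor A B) C \<and> h \<in> extensional (carrier (tensor A B)) \<and>
        (\<forall>a\<in>carrier A. \<forall>b\<in>carrier B. h (pure_tensor A B a b) = \<beta> a b))"

text \<open>The description in \<^const>\<open>tensor_lift\<close> is the universal property of the tensor product:\<close>

lemma tensor_kernel_normal:
  fixes A :: "('a, 'm) monoid_scheme" and B :: "('b, 'n) monoid_scheme"
  assumes "comm_group A" "comm_group B"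
  shows "tensor_kernel A B \<lhd> free_Abelian_group (carrier A \<times> carrier B)"
proof -
  interpret A: comm_group A by fact
  interpret B: comm_group B by fact
  interpret F: comm_group "free_Abelian_group (carrier A \<times> carrier B)"
    by (rule abelian_free_Abelian_group)
  have keys: "Poly_Mapping.keys (frag_of p - frag_of q - frag_of r) \<subseteq> {p, q, r}" for p q r :: "'a \<times> 'b"
    using keys_diff[of "frag_of p - frag_of q" "frag_of r"] keys_diff[of "frag_of p" "frag_of q"] by auto
  have "frag_of p - frag_of q - frag_of r \<in> carrier (free_Abelian_group (carrier A \<times> carrier B))"
    if "{p, q, r} \<subseteq> carrier A \<times> carrier B" for p q r :: "'a \<times> 'b"
    using keys[of p q r] that by (simp del: insert_subset)
  hence "tensor_relators A B \<subseteq> carrier (free_Abelian_group (carrier A \<times> carrier B))"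
    unfolding tensor_relators_def by (auto simp del: carrier_free_Abelian_group_iff)
  hence "subgroup (tensor_kernel A B) (free_Abelian_group (carrier A \<times> carrier B))"
    unfolding tensor_kernel_def by (rule F.generate_is_subgroup)
  thus ?thesis by (rule F.subgroup_imp_normal)
qed

lemma pure_tensor_in_tensor:
  assumes "a \<in> carrier A" "b \<in> carrier B"
  shows "pure_tensor A B a b \<in> carrier (tensor A B)"
  using assms unfolding pure_tensor_def tensor_def FactGroup_def RCOSETS_def by force

lemma hom_tensor_eqI:
  assumes "comm_group A" "comm_group B" "comm_group C"
    and h: "h \<in> hom (tensor A B) C" and k: "k \<in> hom (tensor A B) C"
    and eq: "\<And>a b. a \<in> carrier A \<Longrightarrow> b \<in> carrier B \<Longrightarrow> h (pure_tensor A B a b) = k (pure_tensor A B a b)"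
    and t: "t \<in> carrier (tensor A B)"
  shows "h t = k t"
proof -
  let ?F = "free_Abelian_group (carrier A \<times> carrier B)"
  let ?N = "tensor_kernel A B"
  interpret C: comm_group C by fact
  interpret N: normal ?N ?F by (rule tensor_kernel_normal) fact+
  interpret T: group "tensor A B" unfolding tensor_def by (rule N.factorgroup_is_group)
  interpret h: group_hom "tensor A B" C h by unfold_locales (rule h)
  interpret k: group_hom "tensor A B" C k by unfold_locales (rule k)
  have q: "group_hom ?F (tensor A B) (\<lambda>x. ?N #>\<^bsub>?F\<^esub> x)"
    by unfold_locales (simp add: tensor_def N.r_coset_hom_Mod)
  interpret q: group_hom ?F "tensor A B" "\<lambda>x. ?N #>\<^bsub>?F\<^esub> x" by (rule q)
  have "h (?N #>\<^bsub>?F\<^esub> z) = k (?N #>\<^bsub>?F\<^esub> z)" if "Poly_Mapping.keys z \<subseteq> carrier A \<times> carrier B" for z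
  proof (rule free_Abelian_group_induct[OF that])
    show "h (?N #>\<^bsub>?F\<^esub> 0) = k (?N #>\<^bsub>?F\<^esub> 0)" using q.hom_one by simp
  next
    fix x y assume "Poly_Mapping.keys x \<subseteq> carrier A \<times> carrier B" "Poly_Mapping.keys y \<subseteq> carrier A \<times> carrier B"
      and IH: "h (?N #>\<^bsub>?F\<^esub> x) = k (?N #>\<^bsub>?F\<^esub> x)" "h (?N #>\<^bsub>?F\<^esub> y) = k (?N #>\<^bsub>?F\<^esub> y)"
    then have x: "x \<in> carrier ?F" and y: "y \<in> carrier ?F" by auto
    have "?N #>\<^bsub>?F\<^esub> (x - y) = (?N #>\<^bsub>?F\<^esub> x) \<otimes>\<^bsub>tensor A B\<^esub> inv\<^bsub>tensor A B\<^esub> (?N #>\<^bsub>?F\<^esub> y)"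
      using q.hom_mult[OF x N.inv_closed[OF y]] q.hom_inv[OF y] y by simp
    then show "h (?N #>\<^bsub>?F\<^esub> (x - y)) = k (?N #>\<^bsub>?F\<^esub> (x - y))"
      using IH q.hom_closed[OF x] q.hom_closed[OF y] by simp
  next
    fix p assume "p \<in> carrier A \<times> carrier B"
    then show "h (?N #>\<^bsub>?F\<^esub> frag_of p) = k (?N #>\<^bsub>?F\<^esub> frag_of p)"
      using eq[of "fst p" "snd p"] by (auto simp: pure_tensor_def)
  qed
  thus ?thesis using t unfolding tensor_def FactGroup_def RCOSETS_def by auto
qed

lemma tensor_universal:
  assumes A: "comm_group A" and B: "comm_group B" and C: "comm_group C"
    and \<beta>: "biadditive A B C \<beta>"
  shows "\<exists>!h. h \<in> hom (tensor A B) C \<and> h \<in> extensional (carrier (tensor A B)) \<and>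
        (\<forall>a\<in>carrier A. \<forall>b\<in>carrier B. h (pure_tensor A B a b) = \<beta> a b)"
proof -
  let ?F = "free_Abelian_group (carrier A \<times> carrier B)"
  let ?N = "tensor_kernel A B"
  interpret A: comm_group A by fact
  interpret B: comm_group B by fact
  interpret C: comm_group C by fact
  interpret N: normal ?N ?F by (rule tensor_kernel_normal) fact+
  have cl: "\<beta> a b \<in> carrier C" if "a \<in> carrier A" "b \<in> carrier B" for a b
    using \<beta> that unfolding biadditive_def hom_def by blast
  then have "(\<lambda>p. \<beta> (fst p) (snd p)) ` (carrier A \<times> carrier B) \<subseteq> carrier C" by auto
  from C.free_Abelian_group_universal[OF this] obtain h0 where h0: "h0 \<in> hom ?F C"
    "\<And>p. p \<in> carrier A \<times> carrier B \<Longrightarrow> h0 (frag_of p) = \<beta> (fst p) (snd p)"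
    by blast
  interpret h0: group_hom ?F C h0 by unfold_locales (rule h0)
  have diff: "h0 (x - y) = h0 x \<otimes>\<^bsub>C\<^esub> inv\<^bsub>C\<^esub> h0 y" if "x \<in> carrier ?F" "y \<in> carrier ?F" for x y
    using h0.hom_mult[OF that(1) N.inv_closed[OF that(2)]] that h0.hom_inv[OF that(2)] by simp
  have diffc: "x - y \<in> carrier ?F" if "x \<in> carrier ?F" "y \<in> carrier ?F" for x y
    using N.m_closed[OF that(1) N.inv_closed[OF that(2)]] that by simp
  have "tensor_relators A B \<subseteq> kernel ?F C h0"
  proof -
    have 1: "frag_of p - frag_of q - frag_of r \<in> kernel ?F C h0"
      if "p \<in> carrier A \<times> carrier B" "q \<in> carrier A \<times> carrier B" "r \<in> carrier A \<times> carrier B"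
        "\<beta> (fst p) (snd p) = \<beta> (fst q) (snd q) \<otimes>\<^bsub>C\<^esub> \<beta> (fst r) (snd r)" for p q r
    proof -
      have c: "frag_of p \<in> carrier ?F" "frag_of q \<in> carrier ?F" "frag_of r \<in> carrier ?F"
        using that by (auto simp del: carrier_free_Abelian_group_iff)
      have qr: "\<beta> (fst q) (snd q) \<in> carrier C" "\<beta> (fst r) (snd r) \<in> carrier C"
        using that cl by auto
      have "h0 (frag_of p - frag_of q - frag_of r) = \<one>\<^bsub>C\<^esub>"
        using that qr C.m_comm[OF qr]
        by (simp add: diff[OF diffc[OF c(1,2)] c(3)] diff[OF c(1,2)] h0(2) C.m_assoc)
      thus ?thesis using diffc[OF diffc[OF c(1,2)] c(3)] by (simp add: kernel_def)
    qed
    have 2: "\<beta> (a \<otimes>\<^bsub>A\<^esub> a') b = \<beta> a b \<otimes>\<^bsub>C\<^esub> \<beta> a' b"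
      if "a \<in> carrier A" "a' \<in> carrier A" "b \<in> carrier B" for a a' b
      using \<beta> that unfolding biadditive_def hom_def by blast
    have 3: "\<beta> a (b \<otimes>\<^bsub>B\<^esub> b') = \<beta> a b \<otimes>\<^bsub>C\<^esub> \<beta> a b'"
      if "a \<in> carrier A" "b \<in> carrier B" "b' \<in> carrier B" for a b b'
      using \<beta> that unfolding biadditive_def hom_def by blast
    show ?thesis
      unfolding tensor_relators_def using 2 3 by (auto intro!: 1)
  qed
  then have "?N \<subseteq> kernel ?F C h0"
    unfolding tensor_kernel_def by (intro N.generate_subgroup_incl h0.subgroup_kernel)
  from h0.FactGroup_universal_kernel[OF N.normal_axioms this]
  obtain h where h: "h \<in> hom (tensor A B) C"
    "\<And>x. x \<in> carrier ?F \<Longrightarrow> h (?N #>\<^bsub>?F\<^esub> x) = h0 x"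
    unfolding tensor_def by blast
  interpret T: group "tensor A B" unfolding tensor_def by (rule N.factorgroup_is_group)
  have hp: "h (pure_tensor A B a b) = \<beta> a b" if "a \<in> carrier A" "b \<in> carrier B" for a b
    using that h(2)[of "frag_of (a, b)"] h0(2)[of "(a, b)"] by (simp add: pure_tensor_def)
  show ?thesis
  proof (rule ex1I[of _ "restrict h (carrier (tensor A B))"])
    show "restrict h (carrier (tensor A B)) \<in> hom (tensor A B) C \<and>
      restrict h (carrier (tensor A B)) \<in> extensional (carrier (tensor A B)) \<and>
      (\<forall>a\<in>carrier A. \<forall>b\<in>carrier B. restrict h (carrier (tensor A B)) (pure_tensor A B a b) = \<beta> a b)"
      using h(1) hp by (auto simp: pure_tensor_in_tensor hom_def Pi_iff)
  next
    fix k assume k: "k \<in> hom (tensor A B) C \<and> k \<in> extensional (carrier (tensor A B)) \<and>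
        (\<forall>a\<in>carrier A. \<forall>b\<in>carrier B. k (pure_tensor A B a b) = \<beta> a b)"
    show "k = restrict h (carrier (tensor A B))"
    proof (rule extensionalityI[of _ "carrier (tensor A B)"])
      fix t assume "t \<in> carrier (tensor A B)"
      then show "k t = restrict h (carrier (tensor A B)) t"
        using hom_tensor_eqI[OF A B C _ h(1), of k t] k hp by auto
    qed (use k in auto)
  qed
qed

definition tensor_map :: "('a, 'm) monoid_scheme \<Rightarrow> ('b, 'n) monoid_scheme
    \<Rightarrow> ('c, 'k) monoid_scheme \<Rightarrow> ('d, 'l) monoid_scheme \<Rightarrow> ('a \<Rightarrow> 'c) \<Rightarrow> ('b \<Rightarrow> 'd)
    \<Rightarrow> ('a \<times> 'b \<Rightarrow>\<^sub>0 int) set \<Rightarrow> ('c \<times> 'd \<Rightarrow>\<^sub>0 int) set" where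
  "tensor_map A B C D f g = tensor_lift A B (tensor C D) (\<lambda>a b. pure_tensor C D (f a) (g b))"

definition tensor_assoc :: "('a, 'm) monoid_scheme \<Rightarrow> ('b, 'n) monoid_scheme \<Rightarrow> ('c, 'k) monoid_scheme
    \<Rightarrow> (('a \<times> 'b \<Rightarrow>\<^sub>0 int) set \<times> 'c \<Rightarrow>\<^sub>0 int) set
    \<Rightarrow> ('a \<times> ('b \<times> 'c \<Rightarrow>\<^sub>0 int) set \<Rightarrow>\<^sub>0 int) set" where
  "tensor_assoc A B C =
     tensor_lift (tensor A B) C (tensor A (tensor B C))
       (\<lambda>t c. tensor_lift A B (tensor A (tensor B C))
          (\<lambda>a b. pure_tensor A (tensor B C) a (pure_tensor B C b c)) t)"

definition tensor_lunit :: "('a, 'm) monoid_scheme \<Rightarrow> (int \<times> 'a \<Rightarrow>\<^sub>0 int) set \<Rightarrow> 'a" where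
  "tensor_lunit A = tensor_lift integer_group A A (\<lambda>n a. a [^]\<^bsub>A\<^esub> n)"

definition tensor_runit :: "('a, 'm) monoid_scheme \<Rightarrow> ('a \<times> int \<Rightarrow>\<^sub>0 int) set \<Rightarrow> 'a" where
  "tensor_runit A = tensor_lift A integer_group A (\<lambda>a n. a [^]\<^bsub>A\<^esub> n)"


section \<open>Lax monoidal functors from an idempotent semiring to abelian groups\<close>

text \<open>\<open>fob F e\<close> is the group \<open>F(e)\<close>; \<open>far F e e'\<close> is the map \<open>F(e \<le> e')\<close>, relevant only when
  \<open>e \<le> e'\<close>; \<open>fun1 F\<close> is \<open>\<iota>\<close> and \<open>fmu F X Y\<close> is \<open>\<mu>\<^bsub>X,Y\<^esub>\<close>.\<close>

record ('q, 'a) lax_functor =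
  fob :: "'q \<Rightarrow> 'a monoid"
  far :: "'q \<Rightarrow> 'q \<Rightarrow> 'a \<Rightarrow> 'a"
  fun1 :: "int \<Rightarrow> 'a"
  fmu :: "'q \<Rightarrow> 'q \<Rightarrow> ('a \<times> 'a \<Rightarrow>\<^sub>0 int) set \<Rightarrow> 'a"

definition functor_to_Ab :: "('q, 'm) ring_scheme \<Rightarrow> ('q, 'a) lax_functor \<Rightarrow> bool" where
  "functor_to_Ab Q F \<longleftrightarrow>
     (\<forall>e\<in>carrier Q. comm_group (fob F e)) \<and>
     (\<forall>e e'. idem_le Q e e' \<longrightarrow> far F e e' \<in> hom (fob F e) (fob F e')) \<and>
     (\<forall>e\<in>carrier Q. \<forall>x\<in>carrier (fob F e). far F e e x = x) \<and>
     (\<forall>e e' e''. idem_le Q e e' \<longrightarrow> idem_le Q e' e'' \<longrightarrow>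
        (\<forall>x\<in>carrier (fob F e). far F e e'' x = far F e' e'' (far F e e' x)))"

text \<open>The associator and unitors of \<open>Q\<close> are identities, because \<open>Q\<close> is strict.\<close>

definition lax_monoidal_functor :: "('q, 'm) ring_scheme \<Rightarrow> ('q, 'a) lax_functor \<Rightarrow> bool" where
  "lax_monoidal_functor Q F \<longleftrightarrow> functor_to_Ab Q F \<and>
     fun1 F \<in> hom integer_group (fob F \<one>\<^bsub>Q\<^esub>) \<and>
     (\<forall>X\<in>carrier Q. \<forall>Y\<in>carrier Q.
        fmu F X Y \<in> hom (tensor (fob F X) (fob F Y)) (fob F (X \<otimes>\<^bsub>Q\<^esub> Y))) \<and>
     \<comment> \<open>naturality of \<open>\<mu>\<close>\<close>
     (\<forall>X X' Y Y'. idem_le Q X X' \<longrightarrow> idem_le Q Y Y' \<longrightarrow>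
        (\<forall>t\<in>carrier (tensor (fob F X) (fob F Y)).
           far F (X \<otimes>\<^bsub>Q\<^esub> Y) (X' \<otimes>\<^bsub>Q\<^esub> Y') (fmu F X Y t) =
           fmu F X' Y' (tensor_map (fob F X) (fob F Y) (fob F X') (fob F Y')
                          (far F X X') (far F Y Y') t))) \<and>
     \<comment> \<open>associativity\<close>
     (\<forall>X\<in>carrier Q. \<forall>Y\<in>carrier Q. \<forall>Z\<in>carrier Q.
        \<forall>t\<in>carrier (tensor (tensor (fob F X) (fob F Y)) (fob F Z)).
          fmu F (X \<otimes>\<^bsub>Q\<^esub> Y) Z
            (tensor_map (tensor (fob F X) (fob F Y)) (fob F Z) (fob F (X \<otimes>\<^bsub>Q\<^esub> Y)) (fob F Z)
               (fmu F X Y) (\<lambda>z. z) t) =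
          fmu F X (Y \<otimes>\<^bsub>Q\<^esub> Z)
            (tensor_map (fob F X) (tensor (fob F Y) (fob F Z)) (fob F X) (fob F (Y \<otimes>\<^bsub>Q\<^esub> Z))
               (\<lambda>x. x) (fmu F Y Z)
               (tensor_assoc (fob F X) (fob F Y) (fob F Z) t))) \<and>
     \<comment> \<open>left and right unit laws\<close>
     (\<forall>X\<in>carrier Q. \<forall>t\<in>carrier (tensor integer_group (fob F X)).
        fmu F \<one>\<^bsub>Q\<^esub> X
          (tensor_map integer_group (fob F X) (fob F \<one>\<^bsub>Q\<^esub>) (fob F X) (fun1 F) (\<lambda>x. x) t) =
        tensor_lunit (fob F X) t) \<and>
     (\<forall>X\<in>carrier Q. \<forall>t\<in>carrier (tensor (fob F X) integer_group).
        fmu F X \<one>\<^bsub>Q\<^esub>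
          (tensor_map (fob F X) integer_group (fob F X) (fob F \<one>\<^bsub>Q\<^esub>) (\<lambda>x. x) (fun1 F) t) =
        tensor_runit (fob F X) t)"

text \<open>The lax monoidal functor \<open>F \<circ> f\<close>, for \<open>f\<close> a semiring homomorphism, which is in particular a
  strict monoidal functor.\<close>

definition lax_precomp :: "('p, 'a) lax_functor \<Rightarrow> ('q \<Rightarrow> 'p) \<Rightarrow> ('q, 'a) lax_functor" where
  "lax_precomp F f =
     \<lparr> fob = (\<lambda>e. fob F (f e)), far = (\<lambda>e e'. far F (f e) (f e')),
       fun1 = fun1 F, fmu = (\<lambda>X Y. fmu F (f X) (f Y)) \<rparr>"

definition nat_transformations ::
  "('q, 'm) ring_scheme \<Rightarrow> ('q, 'a) lax_functor \<Rightarrow> ('q, 'b) lax_functor \<Rightarrow> ('q \<Rightarrow> 'a \<Rightarrow> 'b) set" where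
  "nat_transformations Q F G =
     {\<alpha> \<in> extensional (carrier Q).
        (\<forall>e\<in>carrier Q. \<alpha> e \<in> hom (fob F e) (fob G e) \<inter> extensional (carrier (fob F e))) \<and>
        (\<forall>e e'. idem_le Q e e' \<longrightarrow>
           (\<forall>x\<in>carrier (fob F e). \<alpha> e' (far F e e' x) = far G e e' (\<alpha> e x)))}"

definition monoidal_transformation ::
  "('q, 'm) ring_scheme \<Rightarrow> ('q, 'a) lax_functor \<Rightarrow> ('q, 'b) lax_functor \<Rightarrow> ('q \<Rightarrow> 'a \<Rightarrow> 'b) \<Rightarrow> bool" where
  "monoidal_transformation Q F G \<alpha> \<longleftrightarrow>
     (\<forall>n. \<alpha> \<one>\<^bsub>Q\<^esub> (fun1 F n) = fun1 G n) \<and>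
     (\<forall>X\<in>carrier Q. \<forall>Y\<in>carrier Q. \<forall>t\<in>carrier (tensor (fob F X) (fob F Y)).
        \<alpha> (X \<otimes>\<^bsub>Q\<^esub> Y) (fmu F X Y t) =
        fmu G X Y (tensor_map (fob F X) (fob F Y) (fob G X) (fob G Y) (\<alpha> X) (\<alpha> Y) t))"


section \<open>The category of pairs\<close>

text \<open>Naturality of \<open>\<alpha>\<close> alone only yields an additive map: for trivial \<open>Q\<close> a lax monoidal functor
  is a ring, and natural transformations are all additive maps between the rings.
  Compatibility with \<open>\<iota>\<close> and \<open>\<mu>\<close> is what makes the induced map preserve \<open>1\<close> and products.\<close>

definition pair_homs :: "('q, 'm) ring_scheme \<Rightarrow> ('q, 'a) lax_functor
    \<Rightarrow> ('p, 'n) ring_scheme \<Rightarrow> ('p, 'b) lax_functor \<Rightarrow> (('q \<Rightarrow> 'p) \<times> ('q \<Rightarrow> 'a \<Rightarrow> 'b)) set" where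
  "pair_homs Q F Q' F' =
     {(f, \<alpha>). f \<in> semiring_homs Q Q' \<and> \<alpha> \<in> nat_transformations Q F (lax_precomp F' f) \<and>
        monoidal_transformation Q F (lax_precomp F' f) \<alpha>}"

definition pair_id ::
  "('q, 'm) ring_scheme \<Rightarrow> ('q, 'a) lax_functor \<Rightarrow> ('q \<Rightarrow> 'q) \<times> ('q \<Rightarrow> 'a \<Rightarrow> 'a)" where
  "pair_id Q F = (\<lambda>e\<in>carrier Q. e, \<lambda>e\<in>carrier Q. \<lambda>x\<in>carrier (fob F e). x)"

definition pair_comp :: "('q, 'm) ring_scheme \<Rightarrow> ('q, 'a) lax_functor
    \<Rightarrow> ('p \<Rightarrow> 'r) \<times> ('p \<Rightarrow> 'b \<Rightarrow> 'c) \<Rightarrow> ('q \<Rightarrow> 'p) \<times> ('q \<Rightarrow> 'a \<Rightarrow> 'b)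
    \<Rightarrow> ('q \<Rightarrow> 'r) \<times> ('q \<Rightarrow> 'a \<Rightarrow> 'c)" where
  "pair_comp Q F v u =
     (compose (carrier Q) (fst v) (fst u),
      \<lambda>e\<in>carrier Q. compose (carrier (fob F e)) (snd v (fst u e)) (snd u e))"

definition pair_isomorphic :: "('q, 'm) ring_scheme \<Rightarrow> ('q, 'a) lax_functor
    \<Rightarrow> ('p, 'n) ring_scheme \<Rightarrow> ('p, 'b) lax_functor \<Rightarrow> bool" where
  "pair_isomorphic Q F Q' F' \<longleftrightarrow>
     (\<exists>u\<in>pair_homs Q F Q' F'. \<exists>v\<in>pair_homs Q' F' Q F.
        pair_comp Q F v u = pair_id Q F \<and> pair_comp Q' F' u v = pair_id Q' F')"


section \<open>The inverse semiring of a pair\<close>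

definition assoc_semiring ::
  "('q, 'm) ring_scheme \<Rightarrow> ('q, 'a) lax_functor \<Rightarrow> ('q \<times> 'a) ring" where
  "assoc_semiring Q F =
     \<lparr> carrier = (SIGMA e:carrier Q. carrier (fob F e)),
       monoid.mult = (\<lambda>(e\<^sub>1, g\<^sub>1) (e\<^sub>2, g\<^sub>2).
         (e\<^sub>1 \<otimes>\<^bsub>Q\<^esub> e\<^sub>2, fmu F e\<^sub>1 e\<^sub>2 (pure_tensor (fob F e\<^sub>1) (fob F e\<^sub>2) g\<^sub>1 g\<^sub>2))),
       monoid.one = (\<one>\<^bsub>Q\<^esub>, fun1 F 1),
       ring.zero = (\<zero>\<^bsub>Q\<^esub>, \<one>\<^bsub>fob F \<zero>\<^bsub>Q\<^esub>\<^esub>),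
       ring.add = (\<lambda>(e\<^sub>1, g\<^sub>1) (e\<^sub>2, g\<^sub>2).
         (e\<^sub>1 \<oplus>\<^bsub>Q\<^esub> e\<^sub>2,
          far F e\<^sub>1 (e\<^sub>1 \<oplus>\<^bsub>Q\<^esub> e\<^sub>2) g\<^sub>1 \<otimes>\<^bsub>fob F (e\<^sub>1 \<oplus>\<^bsub>Q\<^esub> e\<^sub>2)\<^esub> far F e\<^sub>2 (e\<^sub>1 \<oplus>\<^bsub>Q\<^esub> e\<^sub>2) g\<^sub>2)) \<rparr>"

definition induced_map :: "('q, 'm) ring_scheme \<Rightarrow> ('q, 'a) lax_functor
    \<Rightarrow> ('q \<Rightarrow> 'p) \<times> ('q \<Rightarrow> 'a \<Rightarrow> 'b) \<Rightarrow> 'q \<times> 'a \<Rightarrow> 'p \<times> 'b" where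
  "induced_map Q F u = (\<lambda>(e, g)\<in>carrier (assoc_semiring Q F). (fst u e, snd u e g))"

end

theory Submission
  imports Defs
begin

text \<open>
  Every element of an inverse semiring lies over the additive idempotent \<open>x + x\<^sup>*\<close>, and the
  elements over a fixed idempotent \<open>e\<close> form an abelian group \<open>F e\<close> with neutral element \<open>e\<close>; adding
  \<open>e'\<close> maps \<open>F e\<close> to \<open>F e'\<close> for \<open>e \<le> e'\<close>. Since \<open>(x y)\<^sup>* = x\<^sup>* y = x y\<^sup>*\<close>, multiplication is biadditive on
  these groups and compatible with the idempotents, so it makes \<open>F\<close> lax monoidal. Conversely, the
  idempotents of the semiring of pairs \<open>(e, g)\<close> are the pairs \<open>(e, 1)\<close>, which a homomorphism
  preserves, and \<open>(e, g)\<close> lies over the same idempotent as \<open>(e, 1)\<close>; therefore a homomorphism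
  determines \<open>f\<close> and the components of \<open>\<alpha>\<close>.
\<close>

section \<open>Tensor products\<close>

text \<open>The coherence conditions quantify over arbitrary elements of quotients of free abelian
  groups. Both sides of each condition are homomorphisms out of a tensor product, so they agree once
  they agree on pure tensors, and \<iota> is determined by \<iota>(1). What remains are equations
  between elements: associativity and unit laws of \<mu> are those of the product of pairs, and
  naturality of \<mu> serves distributivity, since a sum first moves its terms to a common fibre. In
  the other direction the obstacle is naturality: \<open>(x + X') (y + Y')\<close> has cross terms.
  Each contains an additive idempotent, and a product with an idempotent depends on the other factor
  only through the idempotent below it, so both are absorbed by \<open>X' Y'\<close>. For morphisms,
  naturality of \<alpha> accounts for the additive structure, compatibility with \<iota> and \<mu>
  for the multiplicative one. This equivalence is proved once; identities, composites and pairs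
  recovered from homomorphisms get their monoidality from it.\<close>

lemma biadditive_closed:
  assumes "biadditive A B C \<beta>" "a \<in> carrier A" "b \<in> carrier B"
  shows "\<beta> a b \<in> carrier C"
  using assms unfolding biadditive_def hom_def by blast

lemma biadditive_mult_left:
  assumes "biadditive A B C \<beta>" "a \<in> carrier A" "a' \<in> carrier A" "b \<in> carrier B"
  shows "\<beta> (a \<otimes>\<^bsub>A\<^esub> a') b = \<beta> a b \<otimes>\<^bsub>C\<^esub> \<beta> a' b"
  using assms unfolding biadditive_def hom_def by blast

lemma biadditive_mult_right:
  assumes "biadditive A B C \<beta>" "a \<in> carrier A" "b \<in> carrier B" "b' \<in> carrier B"
  shows "\<beta> a (b \<otimes>\<^bsub>B\<^esub> b') = \<beta> a b \<otimes>\<^bsub>C\<^esub> \<beta> a b'"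
  using assms unfolding biadditive_def hom_def by blast

lemma biadditiveI:
  assumes "\<And>a b. a \<in> carrier A \<Longrightarrow> b \<in> carrier B \<Longrightarrow> \<beta> a b \<in> carrier C"
    and "\<And>a a' b. a \<in> carrier A \<Longrightarrow> a' \<in> carrier A \<Longrightarrow> b \<in> carrier B \<Longrightarrow>
      \<beta> (a \<otimes>\<^bsub>A\<^esub> a') b = \<beta> a b \<otimes>\<^bsub>C\<^esub> \<beta> a' b"
    and "\<And>a b b'. a \<in> carrier A \<Longrightarrow> b \<in> carrier B \<Longrightarrow> b' \<in> carrier B \<Longrightarrow>
      \<beta> a (b \<otimes>\<^bsub>B\<^esub> b') = \<beta> a b \<otimes>\<^bsub>C\<^esub> \<beta> a b'"
  shows "biadditive A B C \<beta>"
  using assms unfolding biadditive_def hom_def by auto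

lemma biadditive_comp:
  assumes "biadditive A B C \<beta>" "f \<in> hom A' A" "g \<in> hom B' B" "h \<in> hom C D"
  shows "biadditive A' B' D (\<lambda>a b. h (\<beta> (f a) (g b)))"
proof -
  note f = hom_in_carrier[OF assms(2)] and g = hom_in_carrier[OF assms(3)]
  note \<beta> = biadditive_closed[OF assms(1) f g]
  show ?thesis
    by (intro biadditiveI)
      (simp_all add: f g \<beta> hom_mult[OF assms(2)] hom_mult[OF assms(3)] hom_mult[OF assms(4)]
        hom_in_carrier[OF assms(4)] biadditive_mult_left[OF assms(1)] biadditive_mult_right[OF assms(1)])
qed

lemma id_in_hom: "(\<lambda>x. x) \<in> hom G G"
  by (simp add: hom_def)

section \<open>Pure tensors and the test for equality of homomorphisms\<close>

lemma comm_group_tensor: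
  assumes "comm_group A" "comm_group B"
  shows "comm_group (tensor A B)"
  using comm_group.abelian_FactGroup[OF abelian_free_Abelian_group
      normal_imp_subgroup[OF tensor_kernel_normal[OF assms]]]
  by (simp add: tensor_def)

text \<open>A relator \<open>p - q - r\<close> lies in the kernel, so the coset of \<open>p\<close>
  is the product of the cosets of \<open>q\<close> and \<open>r\<close>. The two families of
  relators are the two additivity laws.\<close>

lemma biadditive_pure_tensor:
  assumes "comm_group A" "comm_group B"
  shows "biadditive A B (tensor A B) (pure_tensor A B)"
proof -
  let ?F = "free_Abelian_group (carrier A \<times> carrier B)"
  let ?N = "tensor_kernel A B"
  interpret A: comm_group A by fact
  interpret B: comm_group B by fact
  interpret N: normal ?N ?F by (rule tensor_kernel_normal) fact+
  have q: "(\<lambda>x. ?N #>\<^bsub>?F\<^esub> x) \<in> hom ?F (tensor A B)"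
    by (simp add: tensor_def N.r_coset_hom_Mod)
  have coset: "?N #>\<^bsub>?F\<^esub> frag_of p = (?N #>\<^bsub>?F\<^esub> frag_of q) \<otimes>\<^bsub>tensor A B\<^esub> (?N #>\<^bsub>?F\<^esub> frag_of r)"
    if "frag_of p - frag_of q - frag_of r \<in> tensor_relators A B"
      "q \<in> carrier A \<times> carrier B" "r \<in> carrier A \<times> carrier B" for p q r
  proof -
    have c: "frag_of q \<in> carrier ?F" "frag_of r \<in> carrier ?F"
      using that by (auto simp del: carrier_free_Abelian_group_iff)
    have "frag_of p - frag_of q - frag_of r \<in> ?N"
      unfolding tensor_kernel_def by (rule generate.incl) (fact that(1))
    moreover have "frag_of p = (frag_of p - frag_of q - frag_of r) \<otimes>\<^bsub>?F\<^esub> (frag_of q \<otimes>\<^bsub>?F\<^esub> frag_of r)"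
      by simp
    ultimately have "frag_of p \<in> ?N #>\<^bsub>?F\<^esub> (frag_of q \<otimes>\<^bsub>?F\<^esub> frag_of r)"
      unfolding r_coset_def by blast
    then have "?N #>\<^bsub>?F\<^esub> (frag_of q \<otimes>\<^bsub>?F\<^esub> frag_of r) = ?N #>\<^bsub>?F\<^esub> frag_of p"
      using N.repr_independence[OF _ N.m_closed[OF c] N.subgroup_axioms] by blast
    then show ?thesis using hom_mult[OF q c] by simp
  qed
  show ?thesis
    by (intro biadditiveI pure_tensor_in_tensor; (unfold pure_tensor_def)?; (rule coset)?)
      (auto simp: tensor_relators_def)
qed

lemma biadditive_hom_pure_tensor:
  assumes "comm_group A" "comm_group B" "h \<in> hom (tensor A B) C"
  shows "biadditive A B C (\<lambda>a b. h (pure_tensor A B a b))"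
  by (rule biadditive_comp[OF biadditive_pure_tensor[OF assms(1,2)] id_in_hom id_in_hom assms(3)])

text \<open>Stated as an equivalence so that quantified conditions can be rewritten in place: they
  occur as hypotheses on a given functor and as goals for a constructed one.\<close>

lemma hom_tensor_eq_iff:
  assumes "comm_group A" "comm_group B" "comm_group C"
    "h \<in> hom (tensor A B) C" "k \<in> hom (tensor A B) C"
  shows "(\<forall>t\<in>carrier (tensor A B). h t = k t) \<longleftrightarrow>
    (\<forall>a\<in>carrier A. \<forall>b\<in>carrier B. h (pure_tensor A B a b) = k (pure_tensor A B a b))"
  using hom_tensor_eqI[OF assms] by (auto simp: pure_tensor_in_tensor)

text \<open>Fixing \<open>c\<close> leaves a homomorphism on \<open>tensor A B\<close>, so the
  criterion for one tensor product applies twice. This is the form needed for the associativity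
  condition.\<close>

lemma hom_tensor_tensor_eq_iff:
  assumes A: "comm_group A" and B: "comm_group B" and C: "comm_group C" and D: "comm_group D"
    and h: "h \<in> hom (tensor (tensor A B) C) D" and k: "k \<in> hom (tensor (tensor A B) C) D"
  shows "(\<forall>t\<in>carrier (tensor (tensor A B) C). h t = k t) \<longleftrightarrow>
    (\<forall>a\<in>carrier A. \<forall>b\<in>carrier B. \<forall>c\<in>carrier C.
       h (pure_tensor (tensor A B) C (pure_tensor A B a b) c) =
       k (pure_tensor (tensor A B) C (pure_tensor A B a b) c))"
proof -
  note AB = comm_group_tensor[OF A B]
  have hom: "(\<lambda>s. f (pure_tensor (tensor A B) C s c)) \<in> hom (tensor A B) D"
    if "f \<in> hom (tensor (tensor A B) C) D" "c \<in> carrier C" for f c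
    using biadditive_hom_pure_tensor[OF AB C that(1)] that(2) by (simp add: biadditive_def)
  have "(\<forall>s\<in>carrier (tensor A B). h (pure_tensor (tensor A B) C s c) = k (pure_tensor (tensor A B) C s c))
      \<longleftrightarrow> (\<forall>a\<in>carrier A. \<forall>b\<in>carrier B.
        h (pure_tensor (tensor A B) C (pure_tensor A B a b) c) =
        k (pure_tensor (tensor A B) C (pure_tensor A B a b) c))" if "c \<in> carrier C" for c
    using hom_tensor_eq_iff[OF A B D hom[OF h that] hom[OF k that]] .
  then show ?thesis
    unfolding hom_tensor_eq_iff[OF AB C D h k] by blast
qed

section \<open>Values of lifts and of the structure maps on pure tensors\<close>

lemma tensor_lift:
  assumes "comm_group A" "comm_group B" "comm_group C" "biadditive A B C \<beta>"
  shows tensor_lift_hom: "tensor_lift A B C \<beta> \<in> hom (tensor A B) C"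
    and tensor_lift_pure: "\<And>a b. a \<in> carrier A \<Longrightarrow> b \<in> carrier B \<Longrightarrow>
      tensor_lift A B C \<beta> (pure_tensor A B a b) = \<beta> a b"
  using theI'[OF tensor_universal[OF assms]] unfolding tensor_lift_def by blast+

lemma tensor_map:
  assumes "comm_group A" "comm_group B" "comm_group C" "comm_group D"
    "f \<in> hom A C" "g \<in> hom B D"
  shows tensor_map_hom: "tensor_map A B C D f g \<in> hom (tensor A B) (tensor C D)"
    and tensor_map_pure: "\<And>a b. a \<in> carrier A \<Longrightarrow> b \<in> carrier B \<Longrightarrow>
      tensor_map A B C D f g (pure_tensor A B a b) = pure_tensor C D (f a) (g b)"
proof -
  have "biadditive A B (tensor C D) (\<lambda>a b. pure_tensor C D (f a) (g b))"
    using assms by (intro biadditive_comp[OF biadditive_pure_tensor _ _ id_in_hom])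
  note lift = tensor_lift[OF assms(1,2) comm_group_tensor[OF assms(3,4)] this]
  show "tensor_map A B C D f g \<in> hom (tensor A B) (tensor C D)"
    "\<And>a b. a \<in> carrier A \<Longrightarrow> b \<in> carrier B \<Longrightarrow>
      tensor_map A B C D f g (pure_tensor A B a b) = pure_tensor C D (f a) (g b)"
    unfolding tensor_map_def using lift by auto
qed

text \<open>The outer lift requires additivity in \<open>c\<close>, although the inner lift is
  described only by its values on pure tensors.\<close>

lemma tensor_assoc:
  assumes A: "comm_group A" and B: "comm_group B" and C: "comm_group C"
  shows tensor_assoc_hom:
      "tensor_assoc A B C \<in> hom (tensor (tensor A B) C) (tensor A (tensor B C))"
    and tensor_assoc_pure: "\<And>a b c. a \<in> carrier A \<Longrightarrow> b \<in> carrier B \<Longrightarrow> c \<in> carrier C \<Longrightarrow>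
      tensor_assoc A B C (pure_tensor (tensor A B) C (pure_tensor A B a b) c) =
      pure_tensor A (tensor B C) a (pure_tensor B C b c)"
proof -
  let ?T = "tensor A (tensor B C)"
  let ?\<beta> = "\<lambda>c a b. pure_tensor A (tensor B C) a (pure_tensor B C b c)"
  let ?l = "\<lambda>t c. tensor_lift A B ?T (?\<beta> c) t"
  note AB = comm_group_tensor[OF A B] and BC = comm_group_tensor[OF B C]
  note T = comm_group_tensor[OF A BC]
  note bBC = biadditive_pure_tensor[OF B C] and bT = biadditive_pure_tensor[OF A BC]
  have "(\<lambda>b. pure_tensor B C b c) \<in> hom B (tensor B C)" if "c \<in> carrier C" for c
    using bBC that by (simp add: biadditive_def)
  then have \<beta>: "biadditive A B ?T (?\<beta> c)" if "c \<in> carrier C" for c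
    using biadditive_comp[OF bT id_in_hom _ id_in_hom] that by blast
  note lift = tensor_lift[OF A B T \<beta>]
  interpret T: comm_group ?T by (fact T)
  \<comment> \<open>Both sides are homomorphisms in \<open>t\<close>, the right one because the
    target is commutative, so pure tensors decide.\<close>
  have add: "?l t (c \<otimes>\<^bsub>C\<^esub> c') = ?l t c \<otimes>\<^bsub>?T\<^esub> ?l t c'"
    if t: "t \<in> carrier (tensor A B)" and c: "c \<in> carrier C" "c' \<in> carrier C" for t c c'
  proof -
    interpret C: comm_group C by (fact C)
    have "(\<lambda>t. ?l t c \<otimes>\<^bsub>?T\<^esub> ?l t c') \<in> hom (tensor A B) ?T"
      using T.hom_group_mult[OF lift(1)[OF c(1)] lift(1)[OF c(2)]] .
    from hom_tensor_eqI[OF A B T lift(1)[OF C.m_closed[OF c]] this _ t] show ?thesis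
      using c by (simp add: lift(2) biadditive_mult_right[OF bBC] biadditive_mult_right[OF bT]
          biadditive_closed[OF bBC])
  qed
  have "biadditive (tensor A B) C ?T ?l"
    using add by (intro biadditiveI) (auto simp: hom_mult[OF lift(1)] hom_in_carrier[OF lift(1)])
  note lift2 = tensor_lift[OF AB C T this]
  show "tensor_assoc A B C \<in> hom (tensor (tensor A B) C) ?T"
    unfolding tensor_assoc_def by (rule lift2(1))
  show "tensor_assoc A B C (pure_tensor (tensor A B) C (pure_tensor A B a b) c) =
      pure_tensor A (tensor B C) a (pure_tensor B C b c)"
    if "a \<in> carrier A" "b \<in> carrier B" "c \<in> carrier C" for a b c
    using that by (simp add: tensor_assoc_def lift2(2) lift(2) pure_tensor_in_tensor)
qed

lemma tensor_lunit:
  assumes "comm_group A"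
  shows tensor_lunit_hom: "tensor_lunit A \<in> hom (tensor integer_group A) A"
    and tensor_lunit_pure: "\<And>n a. a \<in> carrier A \<Longrightarrow>
      tensor_lunit A (pure_tensor integer_group A n a) = a [^]\<^bsub>A\<^esub> n"
proof -
  interpret A: comm_group A by fact
  have "biadditive integer_group A A (\<lambda>n a. a [^]\<^bsub>A\<^esub> n)"
    by (intro biadditiveI) (auto simp: A.int_pow_mult A.int_pow_distrib)
  from tensor_lift[OF abelian_integer_group assms assms this]
  show "tensor_lunit A \<in> hom (tensor integer_group A) A"
    "\<And>n a. a \<in> carrier A \<Longrightarrow> tensor_lunit A (pure_tensor integer_group A n a) = a [^]\<^bsub>A\<^esub> n"
    unfolding tensor_lunit_def by auto
qed

lemma tensor_runit:
  assumes "comm_group A"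
  shows tensor_runit_hom: "tensor_runit A \<in> hom (tensor A integer_group) A"
    and tensor_runit_pure: "\<And>n a. a \<in> carrier A \<Longrightarrow>
      tensor_runit A (pure_tensor A integer_group a n) = a [^]\<^bsub>A\<^esub> n"
proof -
  interpret A: comm_group A by fact
  have "biadditive A integer_group A (\<lambda>a n. a [^]\<^bsub>A\<^esub> n)"
    by (intro biadditiveI) (auto simp: A.int_pow_mult A.int_pow_distrib)
  from tensor_lift[OF assms abelian_integer_group assms this]
  show "tensor_runit A \<in> hom (tensor A integer_group) A"
    "\<And>n a. a \<in> carrier A \<Longrightarrow> tensor_runit A (pure_tensor A integer_group a n) = a [^]\<^bsub>A\<^esub> n"
    unfolding tensor_runit_def by auto
qed


section \<open>Lax monoidal functors on pure tensors\<close>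

text \<open>The integers are generated by 1, so \<iota> carries no information beyond
  \<iota>(1).\<close>

lemma hom_integer_group_eq_pow:
  assumes "group G" "h \<in> hom integer_group G"
  shows "h n = h 1 [^]\<^bsub>G\<^esub> n"
proof -
  interpret h: group_hom integer_group G h
    using assms by (simp add: group_hom_def group_hom_axioms_def)
  show ?thesis using h.hom_int_pow[of 1 n] by simp
qed

abbreviation lax_mult :: "('q, 'a) lax_functor \<Rightarrow> 'q \<Rightarrow> 'q \<Rightarrow> 'a \<Rightarrow> 'a \<Rightarrow> 'a" where
  "lax_mult F X Y a b \<equiv> fmu F X Y (pure_tensor (fob F X) (fob F Y) a b)"

lemma idem_semiring_imp_semiring: "idem_semiring Q \<Longrightarrow> semiring Q"
  by (simp add: idem_semiring_def)

lemma hom_comp: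
  assumes "f \<in> hom A B" "g \<in> hom B C"
  shows "(\<lambda>x. g (f x)) \<in> hom A C"
  using hom_compose[OF assms] by (simp add: comp_def)

lemma hom_int_pow_comm:
  assumes "h \<in> hom A B" "comm_group A" "comm_group B" "x \<in> carrier A"
  shows "h (x [^]\<^bsub>A\<^esub> (n::int)) = h x [^]\<^bsub>B\<^esub> n"
proof -
  interpret group_hom A B h
    using assms by (simp add: group_hom_def group_hom_axioms_def comm_group.axioms)
  show ?thesis using assms(4) by (rule hom_int_pow)
qed

text \<open>All conditions on a lax monoidal functor are equalities of homomorphisms out of tensor
  products, so it suffices to test them on pure tensors.\<close>

lemma lax_monoidal_functor_iff:
  assumes Q: "idem_semiring Q"
  shows "lax_monoidal_functor Q F \<longleftrightarrow> functor_to_Ab Q F \<and>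
     fun1 F \<in> hom integer_group (fob F \<one>\<^bsub>Q\<^esub>) \<and>
     (\<forall>X\<in>carrier Q. \<forall>Y\<in>carrier Q.
        fmu F X Y \<in> hom (tensor (fob F X) (fob F Y)) (fob F (X \<otimes>\<^bsub>Q\<^esub> Y))) \<and>
     (\<forall>X X' Y Y'. idem_le Q X X' \<longrightarrow> idem_le Q Y Y' \<longrightarrow>
        (\<forall>a\<in>carrier (fob F X). \<forall>b\<in>carrier (fob F Y).
           far F (X \<otimes>\<^bsub>Q\<^esub> Y) (X' \<otimes>\<^bsub>Q\<^esub> Y') (lax_mult F X Y a b) =
           lax_mult F X' Y' (far F X X' a) (far F Y Y' b))) \<and>
     (\<forall>X\<in>carrier Q. \<forall>Y\<in>carrier Q. \<forall>Z\<in>carrier Q.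
        \<forall>a\<in>carrier (fob F X). \<forall>b\<in>carrier (fob F Y). \<forall>c\<in>carrier (fob F Z).
          lax_mult F (X \<otimes>\<^bsub>Q\<^esub> Y) Z (lax_mult F X Y a b) c =
          lax_mult F X (Y \<otimes>\<^bsub>Q\<^esub> Z) a (lax_mult F Y Z b c)) \<and>
     (\<forall>X\<in>carrier Q. \<forall>a\<in>carrier (fob F X). lax_mult F \<one>\<^bsub>Q\<^esub> X (fun1 F 1) a = a) \<and>
     (\<forall>X\<in>carrier Q. \<forall>a\<in>carrier (fob F X). lax_mult F X \<one>\<^bsub>Q\<^esub> a (fun1 F 1) = a)"
proof -
  interpret Q: semiring Q using Q by (rule idem_semiring_imp_semiring)
  \<comment> \<open>Products are monotone: expanding \<open>(X + X') (Y + Y')\<close> writes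
    \<open>X' Y'\<close> as a sum with summand \<open>X Y\<close>, which idempotence absorbs. This
    provides the arrow between the products in the naturality square.\<close>
  have le_mult: "idem_le Q (X \<otimes>\<^bsub>Q\<^esub> Y) (X' \<otimes>\<^bsub>Q\<^esub> Y')"
    if "idem_le Q X X'" "idem_le Q Y Y'" for X X' Y Y'
  proof -
    have c: "X \<in> carrier Q" "X' \<in> carrier Q" "Y \<in> carrier Q" "Y' \<in> carrier Q"
      and eq: "X \<oplus>\<^bsub>Q\<^esub> X' = X'" "Y \<oplus>\<^bsub>Q\<^esub> Y' = Y'"
      and idem: "X \<otimes>\<^bsub>Q\<^esub> Y \<oplus>\<^bsub>Q\<^esub> X \<otimes>\<^bsub>Q\<^esub> Y = X \<otimes>\<^bsub>Q\<^esub> Y"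
      using that Q by (auto simp: idem_le_def idem_semiring_def)
    have "X' \<otimes>\<^bsub>Q\<^esub> Y' = (X \<oplus>\<^bsub>Q\<^esub> X') \<otimes>\<^bsub>Q\<^esub> (Y \<oplus>\<^bsub>Q\<^esub> Y')"
      by (simp add: eq)
    also have "\<dots> = X \<otimes>\<^bsub>Q\<^esub> Y \<oplus>\<^bsub>Q\<^esub> (X' \<otimes>\<^bsub>Q\<^esub> Y \<oplus>\<^bsub>Q\<^esub> (X \<otimes>\<^bsub>Q\<^esub> Y' \<oplus>\<^bsub>Q\<^esub> X' \<otimes>\<^bsub>Q\<^esub> Y'))"
      using c by (simp add: Q.l_distr Q.r_distr Q.a_assoc del: eq)
    finally have *: "X' \<otimes>\<^bsub>Q\<^esub> Y' =
      X \<otimes>\<^bsub>Q\<^esub> Y \<oplus>\<^bsub>Q\<^esub> (X' \<otimes>\<^bsub>Q\<^esub> Y \<oplus>\<^bsub>Q\<^esub> (X \<otimes>\<^bsub>Q\<^esub> Y' \<oplus>\<^bsub>Q\<^esub> X' \<otimes>\<^bsub>Q\<^esub> Y'))" .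
    show ?thesis
      unfolding idem_le_def
      by (subst (1 2) *) (use c idem in \<open>simp add: Q.a_assoc[symmetric]\<close>)
  qed
  {
    assume F: "functor_to_Ab Q F"
      and \<iota>: "fun1 F \<in> hom integer_group (fob F \<one>\<^bsub>Q\<^esub>)"
      and \<mu>: "\<forall>X\<in>carrier Q. \<forall>Y\<in>carrier Q.
        fmu F X Y \<in> hom (tensor (fob F X) (fob F Y)) (fob F (X \<otimes>\<^bsub>Q\<^esub> Y))"
    have G: "comm_group (fob F X)" if "X \<in> carrier Q" for X
      using F that by (simp add: functor_to_Ab_def)
    have far: "far F X Y \<in> hom (fob F X) (fob F Y)" if "idem_le Q X Y" for X Y
      using F that by (simp add: functor_to_Ab_def)
    have le: "X \<in> carrier Q" "Y \<in> carrier Q" if "idem_le Q X Y" for X Y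
      using that by (auto simp: idem_le_def)
    note \<mu> = \<mu>[rule_format]
    have natural: "(\<forall>t\<in>carrier (tensor (fob F X) (fob F Y)).
           far F (X \<otimes>\<^bsub>Q\<^esub> Y) (X' \<otimes>\<^bsub>Q\<^esub> Y') (fmu F X Y t) =
           fmu F X' Y' (tensor_map (fob F X) (fob F Y) (fob F X') (fob F Y')
                          (far F X X') (far F Y Y') t)) \<longleftrightarrow>
       (\<forall>a\<in>carrier (fob F X). \<forall>b\<in>carrier (fob F Y).
           far F (X \<otimes>\<^bsub>Q\<^esub> Y) (X' \<otimes>\<^bsub>Q\<^esub> Y') (lax_mult F X Y a b) =
           lax_mult F X' Y' (far F X X' a) (far F Y Y' b))"
      if XY: "idem_le Q X X'" "idem_le Q Y Y'" for X X' Y Y'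
    proof -
      note c = le[OF XY(1)] le[OF XY(2)]
      note map = tensor_map[OF G[OF c(1)] G[OF c(3)] G[OF c(2)] G[OF c(4)] far[OF XY(1)] far[OF XY(2)]]
      show ?thesis
        by (subst hom_tensor_eq_iff[OF G[OF c(1)] G[OF c(3)] G[OF Q.m_closed[OF c(2,4)]]
              hom_comp[OF \<mu>[OF c(1,3)] far[OF le_mult[OF XY]]] hom_comp[OF map(1) \<mu>[OF c(2,4)]]])
          (simp add: map(2))
    qed
    have assoc: "(\<forall>t\<in>carrier (tensor (tensor (fob F X) (fob F Y)) (fob F Z)).
          fmu F (X \<otimes>\<^bsub>Q\<^esub> Y) Z
            (tensor_map (tensor (fob F X) (fob F Y)) (fob F Z) (fob F (X \<otimes>\<^bsub>Q\<^esub> Y)) (fob F Z)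
               (fmu F X Y) (\<lambda>z. z) t) =
          fmu F X (Y \<otimes>\<^bsub>Q\<^esub> Z)
            (tensor_map (fob F X) (tensor (fob F Y) (fob F Z)) (fob F X) (fob F (Y \<otimes>\<^bsub>Q\<^esub> Z))
               (\<lambda>x. x) (fmu F Y Z)
               (tensor_assoc (fob F X) (fob F Y) (fob F Z) t))) \<longleftrightarrow>
       (\<forall>a\<in>carrier (fob F X). \<forall>b\<in>carrier (fob F Y). \<forall>c\<in>carrier (fob F Z).
          lax_mult F (X \<otimes>\<^bsub>Q\<^esub> Y) Z (lax_mult F X Y a b) c =
          lax_mult F X (Y \<otimes>\<^bsub>Q\<^esub> Z) a (lax_mult F Y Z b c))"
      if c: "X \<in> carrier Q" "Y \<in> carrier Q" "Z \<in> carrier Q" for X Y Z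
    proof -
      note g = c[THEN G] and XY = Q.m_closed[OF c(1,2)] and YZ = Q.m_closed[OF c(2,3)]
      note map1 = tensor_map[OF comm_group_tensor[OF g(1,2)] g(3) G[OF XY] g(3) \<mu>[OF c(1,2)] id_in_hom]
      note map2 = tensor_map[OF g(1) comm_group_tensor[OF g(2,3)] g(1) G[OF YZ] id_in_hom \<mu>[OF c(2,3)]]
      \<comment> \<open>Strictness of \<open>Q\<close> enters here: \<open>(X Y) Z\<close> and
        \<open>X (Y Z)\<close> are the same element, so both composites have the same
        codomain.\<close>
      have \<mu>1: "fmu F (X \<otimes>\<^bsub>Q\<^esub> Y) Z \<in>
          hom (tensor (fob F (X \<otimes>\<^bsub>Q\<^esub> Y)) (fob F Z)) (fob F (X \<otimes>\<^bsub>Q\<^esub> (Y \<otimes>\<^bsub>Q\<^esub> Z)))"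
        using \<mu>[OF XY c(3)] by (simp add: c Q.m_assoc)
      show ?thesis
        by (subst hom_tensor_tensor_eq_iff[OF g G[OF Q.m_closed[OF c(1) YZ]] hom_comp[OF map1(1) \<mu>1]
              hom_comp[OF hom_comp[OF tensor_assoc_hom[OF g] map2(1)] \<mu>[OF c(1) YZ]]])
          (simp add: map1(2) map2(2) tensor_assoc_pure[OF g] pure_tensor_in_tensor)
    qed
    have \<iota>_pow: "fun1 F n = fun1 F 1 [^]\<^bsub>fob F \<one>\<^bsub>Q\<^esub>\<^esub> n" for n
      using hom_integer_group_eq_pow[OF _ \<iota>] comm_group.axioms(2)[OF G[OF Q.one_closed]] by blast
    have \<iota>_closed: "fun1 F n \<in> carrier (fob F \<one>\<^bsub>Q\<^esub>)" for n
      using hom_in_carrier[OF \<iota>] by simp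
    have lunit: "(\<forall>t\<in>carrier (tensor integer_group (fob F X)).
        fmu F \<one>\<^bsub>Q\<^esub> X
          (tensor_map integer_group (fob F X) (fob F \<one>\<^bsub>Q\<^esub>) (fob F X) (fun1 F) (\<lambda>x. x) t) =
        tensor_lunit (fob F X) t) \<longleftrightarrow>
      (\<forall>a\<in>carrier (fob F X). lax_mult F \<one>\<^bsub>Q\<^esub> X (fun1 F 1) a = a)"
      if X: "X \<in> carrier Q" for X
    proof -
      note map = tensor_map[OF abelian_integer_group G[OF X] G[OF Q.one_closed] G[OF X] \<iota> id_in_hom]
      have \<mu>1: "fmu F \<one>\<^bsub>Q\<^esub> X \<in> hom (tensor (fob F \<one>\<^bsub>Q\<^esub>) (fob F X)) (fob F X)"
        using \<mu>[OF Q.one_closed X] X by simp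
      note bi = biadditive_hom_pure_tensor[OF G[OF Q.one_closed] G[OF X] \<mu>1]
      \<comment> \<open>Additivity in the first factor makes the value at \<open>n\<close> the
        \<open>n\<close>-th power of the value at 1, so the instance for 1 implies all
        others.\<close>
      have pow: "lax_mult F \<one>\<^bsub>Q\<^esub> X (fun1 F n) a = lax_mult F \<one>\<^bsub>Q\<^esub> X (fun1 F 1) a [^]\<^bsub>fob F X\<^esub> n"
        if "a \<in> carrier (fob F X)" for a n
      proof -
        have "(\<lambda>x. lax_mult F \<one>\<^bsub>Q\<^esub> X x a) \<in> hom (fob F \<one>\<^bsub>Q\<^esub>) (fob F X)"
          using bi that by (simp add: biadditive_def)
        from hom_int_pow_comm[OF this G[OF Q.one_closed] G[OF X] \<iota>_closed] show ?thesis
          by (subst \<iota>_pow) simp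
      qed
      have eq1: "a [^]\<^bsub>fob F X\<^esub> (1::int) = a" if "a \<in> carrier (fob F X)" for a
        using group.int_pow_1[OF comm_group.axioms(2)[OF G[OF X]] that] .
      have "(\<forall>t\<in>carrier (tensor integer_group (fob F X)).
        fmu F \<one>\<^bsub>Q\<^esub> X
          (tensor_map integer_group (fob F X) (fob F \<one>\<^bsub>Q\<^esub>) (fob F X) (fun1 F) (\<lambda>x. x) t) =
        tensor_lunit (fob F X) t) \<longleftrightarrow>
       (\<forall>n. \<forall>a\<in>carrier (fob F X). lax_mult F \<one>\<^bsub>Q\<^esub> X (fun1 F n) a = a [^]\<^bsub>fob F X\<^esub> n)"
        by (subst hom_tensor_eq_iff[OF abelian_integer_group G[OF X] G[OF X] hom_comp[OF map(1) \<mu>1]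
              tensor_lunit_hom[OF G[OF X]]])
          (simp add: map(2) tensor_lunit_pure[OF G[OF X]])
      also have "\<dots> \<longleftrightarrow> (\<forall>a\<in>carrier (fob F X). lax_mult F \<one>\<^bsub>Q\<^esub> X (fun1 F 1) a = a)"
        using pow eq1 by metis
      finally show ?thesis .
    qed
    have runit: "(\<forall>t\<in>carrier (tensor (fob F X) integer_group).
        fmu F X \<one>\<^bsub>Q\<^esub>
          (tensor_map (fob F X) integer_group (fob F X) (fob F \<one>\<^bsub>Q\<^esub>) (\<lambda>x. x) (fun1 F) t) =
        tensor_runit (fob F X) t) \<longleftrightarrow>
      (\<forall>a\<in>carrier (fob F X). lax_mult F X \<one>\<^bsub>Q\<^esub> a (fun1 F 1) = a)"
      if X: "X \<in> carrier Q" for X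
    proof -
      note map = tensor_map[OF G[OF X] abelian_integer_group G[OF X] G[OF Q.one_closed] id_in_hom \<iota>]
      have \<mu>1: "fmu F X \<one>\<^bsub>Q\<^esub> \<in> hom (tensor (fob F X) (fob F \<one>\<^bsub>Q\<^esub>)) (fob F X)"
        using \<mu>[OF X Q.one_closed] X by simp
      note bi = biadditive_hom_pure_tensor[OF G[OF X] G[OF Q.one_closed] \<mu>1]
      have pow: "lax_mult F X \<one>\<^bsub>Q\<^esub> a (fun1 F n) = lax_mult F X \<one>\<^bsub>Q\<^esub> a (fun1 F 1) [^]\<^bsub>fob F X\<^esub> n"
        if "a \<in> carrier (fob F X)" for a n
      proof -
        have "(\<lambda>x. lax_mult F X \<one>\<^bsub>Q\<^esub> a x) \<in> hom (fob F \<one>\<^bsub>Q\<^esub>) (fob F X)"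
          using bi that by (simp add: biadditive_def)
        from hom_int_pow_comm[OF this G[OF Q.one_closed] G[OF X] \<iota>_closed] show ?thesis
          by (subst \<iota>_pow) simp
      qed
      have eq1: "a [^]\<^bsub>fob F X\<^esub> (1::int) = a" if "a \<in> carrier (fob F X)" for a
        using group.int_pow_1[OF comm_group.axioms(2)[OF G[OF X]] that] .
      have "(\<forall>t\<in>carrier (tensor (fob F X) integer_group).
        fmu F X \<one>\<^bsub>Q\<^esub>
          (tensor_map (fob F X) integer_group (fob F X) (fob F \<one>\<^bsub>Q\<^esub>) (\<lambda>x. x) (fun1 F) t) =
        tensor_runit (fob F X) t) \<longleftrightarrow>
       (\<forall>a\<in>carrier (fob F X). \<forall>n. lax_mult F X \<one>\<^bsub>Q\<^esub> a (fun1 F n) = a [^]\<^bsub>fob F X\<^esub> n)"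
        by (subst hom_tensor_eq_iff[OF G[OF X] abelian_integer_group G[OF X] hom_comp[OF map(1) \<mu>1]
              tensor_runit_hom[OF G[OF X]]])
          (simp add: map(2) tensor_runit_pure[OF G[OF X]])
      also have "\<dots> \<longleftrightarrow> (\<forall>a\<in>carrier (fob F X). lax_mult F X \<one>\<^bsub>Q\<^esub> a (fun1 F 1) = a)"
        using pow eq1 by metis
      finally show ?thesis .
    qed
    note natural assoc lunit runit
  }
  \<comment> \<open>The four equivalences are proved under functoriality and the typing of \<iota>
    and \<mu>; \<open>conj_cong\<close> supplies these earlier conjuncts as assumptions.\<close>
  then show ?thesis
    unfolding lax_monoidal_functor_def by (intro conj_cong refl) (simp_all cong: ball_cong imp_cong)
qed


section \<open>The inverse semiring of a lax monoidal functor\<close>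

lemma assoc_semiring_carrier [simp]:
  "(e, g) \<in> carrier (assoc_semiring Q F) \<longleftrightarrow> e \<in> carrier Q \<and> g \<in> carrier (fob F e)"
  by (simp add: assoc_semiring_def)

lemma assoc_semiring_simps [simp]:
  "(e, g) \<otimes>\<^bsub>assoc_semiring Q F\<^esub> (e', g') = (e \<otimes>\<^bsub>Q\<^esub> e', lax_mult F e e' g g')"
  "(e, g) \<oplus>\<^bsub>assoc_semiring Q F\<^esub> (e', g') =
    (e \<oplus>\<^bsub>Q\<^esub> e', far F e (e \<oplus>\<^bsub>Q\<^esub> e') g \<otimes>\<^bsub>fob F (e \<oplus>\<^bsub>Q\<^esub> e')\<^esub> far F e' (e \<oplus>\<^bsub>Q\<^esub> e') g')"
  "\<one>\<^bsub>assoc_semiring Q F\<^esub> = (\<one>\<^bsub>Q\<^esub>, fun1 F 1)"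
  "\<zero>\<^bsub>assoc_semiring Q F\<^esub> = (\<zero>\<^bsub>Q\<^esub>, \<one>\<^bsub>fob F \<zero>\<^bsub>Q\<^esub>\<^esub>)"
  by (simp_all add: assoc_semiring_def)

lemma assoc_semiring_cases:
  assumes "x \<in> carrier (assoc_semiring Q F)"
  obtains e g where "x = (e, g)" "e \<in> carrier Q" "g \<in> carrier (fob F e)"
  using assms by (cases x) auto

locale lax_monoidal = semiring Q for Q :: "('q, 'm) ring_scheme" (structure) +
  fixes F :: "('q, 'a) lax_functor"
  assumes idem: "e \<in> carrier Q \<Longrightarrow> e \<oplus> e = e"
    and lax: "lax_monoidal_functor Q F"
begin

lemma idem_semiring: "idem_semiring Q"
  using idem semiring_axioms by (simp add: idem_semiring_def)

lemmas lax_conds = lax[unfolded lax_monoidal_functor_iff[OF idem_semiring] functor_to_Ab_def]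

section \<open>Order of the semilattice and laws of the functor\<close>

lemma ob_comm_group: "e \<in> carrier Q \<Longrightarrow> comm_group (fob F e)"
  by (insert lax_conds, elim conjE, blast)

lemma ob_group: "e \<in> carrier Q \<Longrightarrow> group (fob F e)"
  using ob_comm_group by (simp add: comm_group_def)

lemma ob_monoid: "e \<in> carrier Q \<Longrightarrow> monoid (fob F e)"
  using ob_group by (simp add: group_def)

lemma le_refl: "e \<in> carrier Q \<Longrightarrow> idem_le Q e e"
  by (simp add: idem_le_def idem)

lemma le_add1: "e \<in> carrier Q \<Longrightarrow> e' \<in> carrier Q \<Longrightarrow> idem_le Q e (e \<oplus> e')"
  by (simp add: idem_le_def idem a_assoc[symmetric])

lemma le_add2: "e \<in> carrier Q \<Longrightarrow> e' \<in> carrier Q \<Longrightarrow> idem_le Q e' (e \<oplus> e')"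
  using le_add1[of e' e] by (simp add: a_comm)

lemma le_trans:
  assumes "idem_le Q e e'" "idem_le Q e' e''"
  shows "idem_le Q e e''"
  using assms a_assoc[of e e' e''] by (auto simp: idem_le_def)

lemma far_hom: "idem_le Q e e' \<Longrightarrow> far F e e' \<in> hom (fob F e) (fob F e')"
  by (insert lax_conds, elim conjE, blast)

lemma far_closed: "idem_le Q e e' \<Longrightarrow> g \<in> carrier (fob F e) \<Longrightarrow> far F e e' g \<in> carrier (fob F e')"
  using hom_in_carrier[OF far_hom] .

lemma far_mult:
  "idem_le Q e e' \<Longrightarrow> g \<in> carrier (fob F e) \<Longrightarrow> g' \<in> carrier (fob F e) \<Longrightarrow>
    far F e e' (g \<otimes>\<^bsub>fob F e\<^esub> g') = far F e e' g \<otimes>\<^bsub>fob F e'\<^esub> far F e e' g'"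
  using hom_mult[OF far_hom] .

lemma far_one: "idem_le Q e e' \<Longrightarrow> far F e e' \<one>\<^bsub>fob F e\<^esub> = \<one>\<^bsub>fob F e'\<^esub>"
  using hom_one[OF far_hom ob_group ob_group] by (auto simp: idem_le_def)

lemma far_id: "e \<in> carrier Q \<Longrightarrow> g \<in> carrier (fob F e) \<Longrightarrow> far F e e g = g"
  by (insert lax_conds, elim conjE, blast)

lemma far_far:
  "idem_le Q e e' \<Longrightarrow> idem_le Q e' e'' \<Longrightarrow> g \<in> carrier (fob F e) \<Longrightarrow>
    far F e' e'' (far F e e' g) = far F e e'' g"
  by (rule sym) (insert lax_conds, elim conjE, blast)

lemma lax_mult_natural:
  "idem_le Q X X' \<Longrightarrow> idem_le Q Y Y' \<Longrightarrow> a \<in> carrier (fob F X) \<Longrightarrow> b \<in> carrier (fob F Y) \<Longrightarrow>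
    lax_mult F X' Y' (far F X X' a) (far F Y Y' b) = far F (X \<otimes> Y) (X' \<otimes> Y') (lax_mult F X Y a b)"
  by (rule sym) (insert lax_conds, elim conjE, blast)

lemma lax_mult_assoc:
  "X \<in> carrier Q \<Longrightarrow> Y \<in> carrier Q \<Longrightarrow> Z \<in> carrier Q \<Longrightarrow>
    a \<in> carrier (fob F X) \<Longrightarrow> b \<in> carrier (fob F Y) \<Longrightarrow> c \<in> carrier (fob F Z) \<Longrightarrow>
    lax_mult F (X \<otimes> Y) Z (lax_mult F X Y a b) c = lax_mult F X (Y \<otimes> Z) a (lax_mult F Y Z b c)"
  by (insert lax_conds, elim conjE, blast)

lemma lax_mult_unit:
  "X \<in> carrier Q \<Longrightarrow> a \<in> carrier (fob F X) \<Longrightarrow> lax_mult F \<one> X (fun1 F 1) a = a"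
  "X \<in> carrier Q \<Longrightarrow> a \<in> carrier (fob F X) \<Longrightarrow> lax_mult F X \<one> a (fun1 F 1) = a"
  by (insert lax_conds, (elim conjE, blast)+)

lemma fun1_hom: "fun1 F \<in> hom integer_group (fob F \<one>)"
  by (insert lax_conds, elim conjE, blast)

lemma fun1_closed: "fun1 F n \<in> carrier (fob F \<one>)"
  using hom_in_carrier[OF fun1_hom] by simp

lemma fmu_hom:
  "X \<in> carrier Q \<Longrightarrow> Y \<in> carrier Q \<Longrightarrow> fmu F X Y \<in> hom (tensor (fob F X) (fob F Y)) (fob F (X \<otimes> Y))"
  by (insert lax_conds, elim conjE, blast)

lemma biadditive_lax_mult:
  "X \<in> carrier Q \<Longrightarrow> Y \<in> carrier Q \<Longrightarrow> biadditive (fob F X) (fob F Y) (fob F (X \<otimes> Y)) (lax_mult F X Y)"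
  using biadditive_hom_pure_tensor[OF ob_comm_group ob_comm_group fmu_hom] .

lemmas lax_mult_closed = biadditive_closed[OF biadditive_lax_mult]

text \<open>Biadditive maps send a neutral argument to the neutral element. This gives both zero
  laws and makes the pairs \<open>(e, 1)\<close> closed under multiplication.\<close>

lemma lax_mult_one:
  assumes "X \<in> carrier Q" "Y \<in> carrier Q"
  shows "a \<in> carrier (fob F X) \<Longrightarrow> lax_mult F X Y a \<one>\<^bsub>fob F Y\<^esub> = \<one>\<^bsub>fob F (X \<otimes> Y)\<^esub>"
    and "b \<in> carrier (fob F Y) \<Longrightarrow> lax_mult F X Y \<one>\<^bsub>fob F X\<^esub> b = \<one>\<^bsub>fob F (X \<otimes> Y)\<^esub>"
  using biadditive_lax_mult[OF assms] assms
    hom_one[of "lax_mult F X Y a", OF _ ob_group ob_group]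
    hom_one[of "\<lambda>a. lax_mult F X Y a b", OF _ ob_group ob_group]
  by (simp_all add: biadditive_def)

section \<open>Sums and products of pairs\<close>

lemma assoc_add_same:
  "e \<in> carrier Q \<Longrightarrow> g \<in> carrier (fob F e) \<Longrightarrow> g' \<in> carrier (fob F e) \<Longrightarrow>
    (e, g) \<oplus>\<^bsub>assoc_semiring Q F\<^esub> (e, g') = (e, g \<otimes>\<^bsub>fob F e\<^esub> g')"
  by (simp add: idem far_id)

text \<open>Adding the idempotent over \<open>e'\<close> transports \<open>g\<close> to the fibre
  over \<open>e + e'\<close>. The transition maps are thus recovered from addition, which is how a
  homomorphism of semirings is seen to respect them.\<close>

lemma assoc_add_one:
  "e \<in> carrier Q \<Longrightarrow> e' \<in> carrier Q \<Longrightarrow> g \<in> carrier (fob F e) \<Longrightarrow>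
    (e, g) \<oplus>\<^bsub>assoc_semiring Q F\<^esub> (e', \<one>\<^bsub>fob F e'\<^esub>) = (e \<oplus> e', far F e (e \<oplus> e') g)"
  using monoid.r_one[OF ob_monoid far_closed[OF le_add1]] by (simp add: far_one le_add2)

lemma assoc_add_closed:
  "e \<in> carrier Q \<Longrightarrow> e' \<in> carrier Q \<Longrightarrow> g \<in> carrier (fob F e) \<Longrightarrow> g' \<in> carrier (fob F e') \<Longrightarrow>
    (e, g) \<oplus>\<^bsub>assoc_semiring Q F\<^esub> (e', g') \<in> carrier (assoc_semiring Q F)"
  by (simp add: monoid.m_closed ob_monoid far_closed le_add1 le_add2)

lemma assoc_add_comm:
  assumes "e \<in> carrier Q" "e' \<in> carrier Q" "g \<in> carrier (fob F e)" "g' \<in> carrier (fob F e')"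
  shows "(e, g) \<oplus>\<^bsub>assoc_semiring Q F\<^esub> (e', g') = (e', g') \<oplus>\<^bsub>assoc_semiring Q F\<^esub> (e, g)"
proof -
  interpret E: comm_group "fob F (e \<oplus> e')" using assms by (intro ob_comm_group) simp
  have "e' \<oplus> e = e \<oplus> e'" using assms by (simp add: a_comm)
  then show ?thesis
    using assms by (simp add: E.m_comm far_closed le_add1 le_add2)
qed

text \<open>Functoriality composes the transition maps, so each bracketing is the sum of the three
  elements transported directly to the join of the three indices, where the group law is
  associative.\<close>

lemma assoc_add_assoc:
  assumes "e1 \<in> carrier Q" "e2 \<in> carrier Q" "e3 \<in> carrier Q"
    and "g1 \<in> carrier (fob F e1)" "g2 \<in> carrier (fob F e2)" "g3 \<in> carrier (fob F e3)"
  shows "(e1, g1) \<oplus>\<^bsub>assoc_semiring Q F\<^esub> (e2, g2) \<oplus>\<^bsub>assoc_semiring Q F\<^esub> (e3, g3) =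
    (e1, g1) \<oplus>\<^bsub>assoc_semiring Q F\<^esub> ((e2, g2) \<oplus>\<^bsub>assoc_semiring Q F\<^esub> (e3, g3))"
proof -
  let ?e = "e1 \<oplus> (e2 \<oplus> e3)"
  have le12: "idem_le Q (e1 \<oplus> e2) ?e"
    using le_add1[of "e1 \<oplus> e2" e3] assms by (simp add: a_assoc)
  have le23: "idem_le Q (e2 \<oplus> e3) ?e" and le1: "idem_le Q e1 ?e"
    using assms by (simp_all add: le_add1 le_add2)
  have le3: "idem_le Q e3 ?e"
    using le_add2[of "e1 \<oplus> e2" e3] assms by (simp add: a_assoc)
  have le2: "idem_le Q e2 ?e"
    using assms le_trans[OF le_add1 le23] by blast
  interpret E: comm_group "fob F ?e" using assms by (intro ob_comm_group) simp
  note cl = far_closed[OF le1 assms(4)] far_closed[OF le2 assms(5)] far_closed[OF le3 assms(6)]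
  have "(e1, g1) \<oplus>\<^bsub>assoc_semiring Q F\<^esub> (e2, g2) \<oplus>\<^bsub>assoc_semiring Q F\<^esub> (e3, g3) =
    (?e, far F e1 ?e g1 \<otimes>\<^bsub>fob F ?e\<^esub> far F e2 ?e g2 \<otimes>\<^bsub>fob F ?e\<^esub> far F e3 ?e g3)"
    using assms far_mult[OF le12] far_far[OF _ le12]
    by (simp add: a_assoc le_add1 le_add2 far_closed)
  also have "\<dots> = (e1, g1) \<oplus>\<^bsub>assoc_semiring Q F\<^esub> ((e2, g2) \<oplus>\<^bsub>assoc_semiring Q F\<^esub> (e3, g3))"
    using assms far_mult[OF le23] far_far[OF _ le23] cl
    by (simp add: le_add1 le_add2 far_closed E.m_assoc)
  finally show ?thesis .
qed

text \<open>Naturality of \<mu>, with the identity arrow of \<open>e3\<close> in the second factor,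
  exchanges transport with multiplication by \<open>g3\<close>; biadditivity in the fibre over the
  join does the rest.\<close>

lemma assoc_l_distr:
  assumes "e1 \<in> carrier Q" "e2 \<in> carrier Q" "e3 \<in> carrier Q"
    and "g1 \<in> carrier (fob F e1)" "g2 \<in> carrier (fob F e2)" "g3 \<in> carrier (fob F e3)"
  shows "((e1, g1) \<oplus>\<^bsub>assoc_semiring Q F\<^esub> (e2, g2)) \<otimes>\<^bsub>assoc_semiring Q F\<^esub> (e3, g3) =
    (e1, g1) \<otimes>\<^bsub>assoc_semiring Q F\<^esub> (e3, g3) \<oplus>\<^bsub>assoc_semiring Q F\<^esub>
    (e2, g2) \<otimes>\<^bsub>assoc_semiring Q F\<^esub> (e3, g3)"
proof -
  have le: "idem_le Q e1 (e1 \<oplus> e2)" "idem_le Q e2 (e1 \<oplus> e2)" "idem_le Q e3 e3"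
    using assms by (simp_all add: le_add1 le_add2 le_refl)
  show ?thesis
    using assms lax_mult_natural[OF le(1,3) assms(4,6)] lax_mult_natural[OF le(2,3) assms(5,6)]
    by (simp add: biadditive_mult_left[OF biadditive_lax_mult] far_closed le l_distr far_id)
qed

lemma assoc_r_distr:
  assumes "e1 \<in> carrier Q" "e2 \<in> carrier Q" "e3 \<in> carrier Q"
    and "g1 \<in> carrier (fob F e1)" "g2 \<in> carrier (fob F e2)" "g3 \<in> carrier (fob F e3)"
  shows "(e3, g3) \<otimes>\<^bsub>assoc_semiring Q F\<^esub> ((e1, g1) \<oplus>\<^bsub>assoc_semiring Q F\<^esub> (e2, g2)) =
    (e3, g3) \<otimes>\<^bsub>assoc_semiring Q F\<^esub> (e1, g1) \<oplus>\<^bsub>assoc_semiring Q F\<^esub>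
    (e3, g3) \<otimes>\<^bsub>assoc_semiring Q F\<^esub> (e2, g2)"
proof -
  have le: "idem_le Q e1 (e1 \<oplus> e2)" "idem_le Q e2 (e1 \<oplus> e2)" "idem_le Q e3 e3"
    using assms by (simp_all add: le_add1 le_add2 le_refl)
  show ?thesis
    using assms lax_mult_natural[OF le(3,1) assms(6,4)] lax_mult_natural[OF le(3,2) assms(6,5)]
    by (simp add: biadditive_mult_right[OF biadditive_lax_mult] far_closed le r_distr far_id)
qed

lemma assoc_zero_add:
  assumes "e \<in> carrier Q" "g \<in> carrier (fob F e)"
  shows "\<zero>\<^bsub>assoc_semiring Q F\<^esub> \<oplus>\<^bsub>assoc_semiring Q F\<^esub> (e, g) = (e, g)"
  using assoc_add_comm[OF assms(1) zero_closed assms(2) monoid.one_closed[OF ob_monoid[OF zero_closed]]]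
    assoc_add_one[OF assms(1) zero_closed assms(2)] assms
  by (simp add: far_id)

lemma semiring_assoc_semiring: "semiring (assoc_semiring Q F)"
proof (intro semiring.intro semiring_axioms.intro abelian_monoidI monoidI)
  let ?S = "assoc_semiring Q F"
  note [simp] = monoid.one_closed[OF ob_monoid] fun1_closed lax_mult_closed
  show "\<zero>\<^bsub>?S\<^esub> \<in> carrier ?S" "\<one>\<^bsub>?S\<^esub> \<in> carrier ?S" by simp_all
  fix x assume "x \<in> carrier ?S"
  then obtain e g where x: "x = (e, g)" "e \<in> carrier Q" "g \<in> carrier (fob F e)"
    by (rule assoc_semiring_cases)
  show "\<zero>\<^bsub>?S\<^esub> \<oplus>\<^bsub>?S\<^esub> x = x" using x by (simp only: assoc_zero_add)
  show "\<one>\<^bsub>?S\<^esub> \<otimes>\<^bsub>?S\<^esub> x = x" "x \<otimes>\<^bsub>?S\<^esub> \<one>\<^bsub>?S\<^esub> = x"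
    "\<zero>\<^bsub>?S\<^esub> \<otimes>\<^bsub>?S\<^esub> x = \<zero>\<^bsub>?S\<^esub>" "x \<otimes>\<^bsub>?S\<^esub> \<zero>\<^bsub>?S\<^esub> = \<zero>\<^bsub>?S\<^esub>"
    using x by (simp_all add: lax_mult_unit lax_mult_one)
  fix y assume "y \<in> carrier ?S"
  then obtain e' g' where y: "y = (e', g')" "e' \<in> carrier Q" "g' \<in> carrier (fob F e')"
    by (rule assoc_semiring_cases)
  show "x \<oplus>\<^bsub>?S\<^esub> y \<in> carrier ?S" "x \<oplus>\<^bsub>?S\<^esub> y = y \<oplus>\<^bsub>?S\<^esub> x"
    unfolding x(1) y(1)
    by (rule assoc_add_closed assoc_add_comm; fact)+
  show "x \<otimes>\<^bsub>?S\<^esub> y \<in> carrier ?S" using x y by simp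
  fix z assume "z \<in> carrier ?S"
  then obtain e'' g'' where z: "z = (e'', g'')" "e'' \<in> carrier Q" "g'' \<in> carrier (fob F e'')"
    by (rule assoc_semiring_cases)
  show "(x \<oplus>\<^bsub>?S\<^esub> y) \<oplus>\<^bsub>?S\<^esub> z = x \<oplus>\<^bsub>?S\<^esub> (y \<oplus>\<^bsub>?S\<^esub> z)"
    using assoc_add_assoc x y z by blast
  show "(x \<otimes>\<^bsub>?S\<^esub> y) \<otimes>\<^bsub>?S\<^esub> z = x \<otimes>\<^bsub>?S\<^esub> (y \<otimes>\<^bsub>?S\<^esub> z)"
    using x y z by (simp add: lax_mult_assoc m_assoc)
  show "(x \<oplus>\<^bsub>?S\<^esub> y) \<otimes>\<^bsub>?S\<^esub> z = x \<otimes>\<^bsub>?S\<^esub> z \<oplus>\<^bsub>?S\<^esub> y \<otimes>\<^bsub>?S\<^esub> z"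
    using assoc_l_distr x y z by blast
  show "z \<otimes>\<^bsub>?S\<^esub> (x \<oplus>\<^bsub>?S\<^esub> y) = z \<otimes>\<^bsub>?S\<^esub> x \<oplus>\<^bsub>?S\<^esub> z \<otimes>\<^bsub>?S\<^esub> y"
    using assoc_r_distr x y z by blast
qed

lemma inverse_semiring_assoc_semiring: "inverse_semiring (assoc_semiring Q F)"
proof -
  let ?S = "assoc_semiring Q F"
  interpret S: semiring ?S by (rule semiring_assoc_semiring)
  have "\<exists>!y. y \<in> carrier ?S \<and> x \<oplus>\<^bsub>?S\<^esub> y \<oplus>\<^bsub>?S\<^esub> x = x \<and> y \<oplus>\<^bsub>?S\<^esub> x \<oplus>\<^bsub>?S\<^esub> y = y"
    if x_in: "x \<in> carrier ?S" for x
  proof -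
    obtain e g where x: "x = (e, g)" "e \<in> carrier Q" "g \<in> carrier (fob F e)"
      using x_in by (rule assoc_semiring_cases)
    interpret E: comm_group "fob F e" by (rule ob_comm_group) (fact x)
    note same = assoc_add_same[OF x(2)]
    show ?thesis
    proof (rule ex1I[of _ "(e, inv\<^bsub>fob F e\<^esub> g)"])
      show "(e, inv\<^bsub>fob F e\<^esub> g) \<in> carrier ?S \<and> x \<oplus>\<^bsub>?S\<^esub> (e, inv\<^bsub>fob F e\<^esub> g) \<oplus>\<^bsub>?S\<^esub> x = x \<and>
        (e, inv\<^bsub>fob F e\<^esub> g) \<oplus>\<^bsub>?S\<^esub> x \<oplus>\<^bsub>?S\<^esub> (e, inv\<^bsub>fob F e\<^esub> g) = (e, inv\<^bsub>fob F e\<^esub> g)"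
        unfolding x(1) by (simp add: same x(2,3) del: assoc_semiring_simps)
    next
      fix y assume y: "y \<in> carrier ?S \<and> x \<oplus>\<^bsub>?S\<^esub> y \<oplus>\<^bsub>?S\<^esub> x = x \<and> y \<oplus>\<^bsub>?S\<^esub> x \<oplus>\<^bsub>?S\<^esub> y = y"
      then have "y \<in> carrier ?S" ..
      then obtain e' g' where y': "y = (e', g')" "e' \<in> carrier Q" "g' \<in> carrier (fob F e')"
        by (rule assoc_semiring_cases)
      \<comment> \<open>In the semilattice these equations say \<open>e' \<le> e\<close> and
        \<open>e \<le> e'\<close>, so an inverse lies in the same fibre, where it must be the group
        inverse.\<close>
      have "e \<oplus> e' \<oplus> e = e" "e' \<oplus> e \<oplus> e' = e'"
        using y by (simp_all add: x(1) y'(1))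
      moreover have "e \<oplus> e' \<oplus> e = e \<oplus> e'" "e' \<oplus> e \<oplus> e' = e \<oplus> e'"
        using x(2) y'(2) a_comm[of e e'] a_assoc[of e' e e] a_assoc[of e e' e']
        by (simp_all add: idem)
      ultimately have "e \<oplus> e' = e" "e \<oplus> e' = e'" by simp_all
      then have e: "e' = e" by simp
      have g': "g' \<in> carrier (fob F e)" using y'(3) by (simp add: e)
      have "g \<otimes>\<^bsub>fob F e\<^esub> g' \<otimes>\<^bsub>fob F e\<^esub> g = g"
        using y g' x(2,3) by (simp add: x(1) y'(1) e same del: assoc_semiring_simps)
      then have "g \<otimes>\<^bsub>fob F e\<^esub> g' = \<one>\<^bsub>fob F e\<^esub>"
        using x(3) g' E.r_cancel_one[OF x(3) E.m_closed[OF x(3) g']] by simp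
      then have "g' = inv\<^bsub>fob F e\<^esub> g"
        using x(3) g' E.inv_equality[of g' g] E.m_comm[OF x(3) g'] by simp
      then show "y = (e, inv\<^bsub>fob F e\<^esub> g)" by (simp add: y'(1) e)
    qed
  qed
  then show ?thesis
    using S.semiring_axioms S.abelian_monoid_axioms
    by (simp add: inverse_semiring_def comm_inverse_monoid_def abelian_monoid_def)
qed

end


section \<open>Homomorphisms\<close>

lemma lax_monoidalI:
  "idem_semiring Q \<Longrightarrow> lax_monoidal_functor Q F \<Longrightarrow> lax_monoidal Q F"
  by (simp add: idem_semiring_def lax_monoidal_def lax_monoidal_axioms_def)

lemma semiring_homsD:
  assumes "h \<in> semiring_homs R S"
  shows "x \<in> carrier R \<Longrightarrow> h x \<in> carrier S"
    and "x \<in> carrier R \<Longrightarrow> y \<in> carrier R \<Longrightarrow> h (x \<otimes>\<^bsub>R\<^esub> y) = h x \<otimes>\<^bsub>S\<^esub> h y"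
    and "x \<in> carrier R \<Longrightarrow> y \<in> carrier R \<Longrightarrow> h (x \<oplus>\<^bsub>R\<^esub> y) = h x \<oplus>\<^bsub>S\<^esub> h y"
    and "h \<one>\<^bsub>R\<^esub> = \<one>\<^bsub>S\<^esub>" and "h \<zero>\<^bsub>R\<^esub> = \<zero>\<^bsub>S\<^esub>"
    and "h \<in> extensional (carrier R)"
  using assms by (auto simp: semiring_homs_def ring_hom_def)

lemma semiring_homsI:
  assumes "\<And>x. x \<in> carrier R \<Longrightarrow> h x \<in> carrier S"
    and "\<And>x y. x \<in> carrier R \<Longrightarrow> y \<in> carrier R \<Longrightarrow> h (x \<otimes>\<^bsub>R\<^esub> y) = h x \<otimes>\<^bsub>S\<^esub> h y"
    and "\<And>x y. x \<in> carrier R \<Longrightarrow> y \<in> carrier R \<Longrightarrow> h (x \<oplus>\<^bsub>R\<^esub> y) = h x \<oplus>\<^bsub>S\<^esub> h y"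
    and "h \<one>\<^bsub>R\<^esub> = \<one>\<^bsub>S\<^esub>" and "h \<zero>\<^bsub>R\<^esub> = \<zero>\<^bsub>S\<^esub>"
    and "h \<in> extensional (carrier R)"
  shows "h \<in> semiring_homs R S"
  using assms by (simp add: semiring_homs_def ring_hom_memI)

lemma semiring_homs_le:
  "f \<in> semiring_homs Q Q' \<Longrightarrow> idem_le Q e e' \<Longrightarrow> idem_le Q' (f e) (f e')"
  using semiring_homsD(1,3)[of f Q Q'] by (fastforce simp: idem_le_def)

lemma nat_transformationsD:
  assumes "\<alpha> \<in> nat_transformations Q F (lax_precomp F' f)"
  shows "e \<in> carrier Q \<Longrightarrow> \<alpha> e \<in> hom (fob F e) (fob F' (f e))"
    and "e \<in> carrier Q \<Longrightarrow> \<alpha> e \<in> extensional (carrier (fob F e))"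
    and "idem_le Q e e' \<Longrightarrow> x \<in> carrier (fob F e) \<Longrightarrow>
      \<alpha> e' (far F e e' x) = far F' (f e) (f e') (\<alpha> e x)"
    and "\<alpha> \<in> extensional (carrier Q)"
  using assms by (auto simp: nat_transformations_def lax_precomp_def)

lemma induced_map_apply [simp]:
  "e \<in> carrier Q \<Longrightarrow> g \<in> carrier (fob F e) \<Longrightarrow> induced_map Q F u (e, g) = (fst u e, snd u e g)"
  by (simp add: induced_map_def)

lemma induced_map_extensional: "induced_map Q F u \<in> extensional (carrier (assoc_semiring Q F))"
  by (simp add: induced_map_def)

locale lax_monoidal_pair = Q: lax_monoidal Q F + Q': lax_monoidal Q' F'
  for Q :: "('q, 'm) ring_scheme" and F :: "('q, 'a) lax_functor"
    and Q' :: "('p, 'n) ring_scheme" and F' :: "('p, 'b) lax_functor"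
begin

text \<open>The same reduction as for functors: both sides are homomorphisms out of a tensor product
  or out of the integers, so pure tensors and the integer 1 suffice.\<close>

lemma monoidal_transformation_iff:
  assumes f: "f \<in> semiring_homs Q Q'"
    and \<alpha>: "\<alpha> \<in> nat_transformations Q F (lax_precomp F' f)"
  shows "monoidal_transformation Q F (lax_precomp F' f) \<alpha> \<longleftrightarrow>
    \<alpha> \<one>\<^bsub>Q\<^esub> (fun1 F 1) = fun1 F' 1 \<and>
    (\<forall>X\<in>carrier Q. \<forall>Y\<in>carrier Q. \<forall>a\<in>carrier (fob F X). \<forall>b\<in>carrier (fob F Y).
       \<alpha> (X \<otimes>\<^bsub>Q\<^esub> Y) (lax_mult F X Y a b) = lax_mult F' (f X) (f Y) (\<alpha> X a) (\<alpha> Y b))"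
proof -
  note f = semiring_homsD[OF f] and \<alpha> = nat_transformationsD[OF \<alpha>]
  have unit: "(\<forall>n. \<alpha> \<one>\<^bsub>Q\<^esub> (fun1 F n) = fun1 F' n) \<longleftrightarrow> \<alpha> \<one>\<^bsub>Q\<^esub> (fun1 F 1) = fun1 F' 1"
  proof -
    have hom: "(\<lambda>n. \<alpha> \<one>\<^bsub>Q\<^esub> (fun1 F n)) \<in> hom integer_group (fob F' \<one>\<^bsub>Q'\<^esub>)"
      using hom_comp[OF Q.fun1_hom \<alpha>(1)] f(4) by simp
    have grp: "group (fob F' \<one>\<^bsub>Q'\<^esub>)" by (simp add: Q'.ob_group)
    show ?thesis
      using hom_integer_group_eq_pow[OF grp hom] hom_integer_group_eq_pow[OF grp Q'.fun1_hom]
      by metis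
  qed
  have mult: "(\<forall>t\<in>carrier (tensor (fob F X) (fob F Y)).
        \<alpha> (X \<otimes>\<^bsub>Q\<^esub> Y) (fmu F X Y t) =
        fmu F' (f X) (f Y) (tensor_map (fob F X) (fob F Y) (fob F' (f X)) (fob F' (f Y)) (\<alpha> X) (\<alpha> Y) t)) \<longleftrightarrow>
     (\<forall>a\<in>carrier (fob F X). \<forall>b\<in>carrier (fob F Y).
       \<alpha> (X \<otimes>\<^bsub>Q\<^esub> Y) (lax_mult F X Y a b) = lax_mult F' (f X) (f Y) (\<alpha> X a) (\<alpha> Y b))"
    if c: "X \<in> carrier Q" "Y \<in> carrier Q" for X Y
  proof -
    note g = c[THEN Q.ob_comm_group] and fc = c[THEN f(1)]
    note map = tensor_map[OF g fc[THEN Q'.ob_comm_group] c[THEN \<alpha>(1)]]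
    have "\<alpha> (X \<otimes>\<^bsub>Q\<^esub> Y) \<in> hom (fob F (X \<otimes>\<^bsub>Q\<^esub> Y)) (fob F' (f X \<otimes>\<^bsub>Q'\<^esub> f Y))"
      using \<alpha>(1)[OF Q.m_closed[OF c]] f(2)[OF c] by simp
    from hom_comp[OF Q.fmu_hom[OF c] this] show ?thesis
      by (subst hom_tensor_eq_iff[OF g Q'.ob_comm_group[OF Q'.m_closed[OF fc]]
            _ hom_comp[OF map(1) Q'.fmu_hom[OF fc]]])
        (simp_all add: map(2))
  qed
  show ?thesis
    unfolding monoidal_transformation_def by (simp add: lax_precomp_def unit mult cong: ball_cong)
qed

text \<open>Sums and zero are preserved for every such pair, because \<alpha> is natural and
  consists of group homomorphisms. Read on pairs, preservation of 1 and of products is compatibility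
  with \<iota> and \<mu>.\<close>

lemma induced_map_hom_iff:
  assumes f: "f \<in> semiring_homs Q Q'"
    and \<alpha>: "\<alpha> \<in> nat_transformations Q F (lax_precomp F' f)"
  shows "induced_map Q F (f, \<alpha>) \<in> semiring_homs (assoc_semiring Q F) (assoc_semiring Q' F') \<longleftrightarrow>
    monoidal_transformation Q F (lax_precomp F' f) \<alpha>" (is "?h \<in> semiring_homs ?S ?S' \<longleftrightarrow> ?mon")
proof
  assume h: "?h \<in> semiring_homs ?S ?S'"
  have "\<alpha> \<one>\<^bsub>Q\<^esub> (fun1 F 1) = fun1 F' 1"
    using semiring_homsD(4)[OF h] by (simp add: Q.fun1_closed)
  moreover have "\<alpha> (X \<otimes>\<^bsub>Q\<^esub> Y) (lax_mult F X Y a b) = lax_mult F' (f X) (f Y) (\<alpha> X a) (\<alpha> Y b)"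
    if "X \<in> carrier Q" "Y \<in> carrier Q" "a \<in> carrier (fob F X)" "b \<in> carrier (fob F Y)" for X Y a b
    using semiring_homsD(2)[OF h, of "(X, a)" "(Y, b)"] that by (simp add: Q.lax_mult_closed)
  ultimately show ?mon unfolding monoidal_transformation_iff[OF f \<alpha>] by blast
next
  note fD = semiring_homsD[OF f] and \<alpha>D = nat_transformationsD[OF \<alpha>]
  have \<alpha>_closed: "\<alpha> e g \<in> carrier (fob F' (f e))" if "e \<in> carrier Q" "g \<in> carrier (fob F e)" for e g
    using hom_in_carrier[OF \<alpha>D(1)] that .
  assume ?mon
  then have mon: "\<alpha> \<one>\<^bsub>Q\<^esub> (fun1 F 1) = fun1 F' 1"
    "\<And>X Y a b. X \<in> carrier Q \<Longrightarrow> Y \<in> carrier Q \<Longrightarrow> a \<in> carrier (fob F X) \<Longrightarrow> b \<in> carrier (fob F Y) \<Longrightarrow>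
       \<alpha> (X \<otimes>\<^bsub>Q\<^esub> Y) (lax_mult F X Y a b) = lax_mult F' (f X) (f Y) (\<alpha> X a) (\<alpha> Y b)"
    unfolding monoidal_transformation_iff[OF f \<alpha>] by blast+
  show "?h \<in> semiring_homs ?S ?S'"
  proof (rule semiring_homsI)
    show "?h \<one>\<^bsub>?S\<^esub> = \<one>\<^bsub>?S'\<^esub>" by (simp add: Q.fun1_closed mon(1) fD(4))
    have "\<alpha> \<zero>\<^bsub>Q\<^esub> \<one>\<^bsub>fob F \<zero>\<^bsub>Q\<^esub>\<^esub> = \<one>\<^bsub>fob F' \<zero>\<^bsub>Q'\<^esub>\<^esub>"
      using hom_one[OF \<alpha>D(1) Q.ob_group Q'.ob_group] by (simp add: fD(5))
    then show "?h \<zero>\<^bsub>?S\<^esub> = \<zero>\<^bsub>?S'\<^esub>" by (simp add: fD(5) monoid.one_closed Q.ob_monoid)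
    show "?h \<in> extensional (carrier ?S)" by (rule induced_map_extensional)
  next
    fix x assume "x \<in> carrier ?S"
    then show "?h x \<in> carrier ?S'"
      by (rule assoc_semiring_cases) (simp add: fD(1) \<alpha>_closed)
  next
    fix x y assume "x \<in> carrier ?S" "y \<in> carrier ?S"
    then obtain e g e' g' where xy: "x = (e, g)" "y = (e', g')"
      and c: "e \<in> carrier Q" "g \<in> carrier (fob F e)" "e' \<in> carrier Q" "g' \<in> carrier (fob F e')"
      by (metis assoc_semiring_cases)
    show "?h (x \<otimes>\<^bsub>?S\<^esub> y) = ?h x \<otimes>\<^bsub>?S'\<^esub> ?h y"
      using c by (simp add: xy Q.lax_mult_closed mon(2) fD(2))
    note le = Q.le_add1[OF c(1,3)] Q.le_add2[OF c(1,3)]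
    have cl: "far F e (e \<oplus>\<^bsub>Q\<^esub> e') g \<in> carrier (fob F (e \<oplus>\<^bsub>Q\<^esub> e'))"
      "far F e' (e \<oplus>\<^bsub>Q\<^esub> e') g' \<in> carrier (fob F (e \<oplus>\<^bsub>Q\<^esub> e'))"
      using Q.far_closed le c by simp_all
    have add: "\<alpha> (e \<oplus>\<^bsub>Q\<^esub> e') (far F e (e \<oplus>\<^bsub>Q\<^esub> e') g \<otimes>\<^bsub>fob F (e \<oplus>\<^bsub>Q\<^esub> e')\<^esub> far F e' (e \<oplus>\<^bsub>Q\<^esub> e') g') =
      far F' (f e) (f e \<oplus>\<^bsub>Q'\<^esub> f e') (\<alpha> e g) \<otimes>\<^bsub>fob F' (f e \<oplus>\<^bsub>Q'\<^esub> f e')\<^esub>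
      far F' (f e') (f e \<oplus>\<^bsub>Q'\<^esub> f e') (\<alpha> e' g')"
      using hom_mult[OF \<alpha>D(1) cl] c le by (simp add: \<alpha>D(3) fD(3))
    show "?h (x \<oplus>\<^bsub>?S\<^esub> y) = ?h x \<oplus>\<^bsub>?S'\<^esub> ?h y"
      using c cl by (simp add: xy add fD(3) monoid.m_closed Q.ob_monoid)
  qed
qed

lemma induced_map_hom:
  assumes "u \<in> pair_homs Q F Q' F'"
  shows "induced_map Q F u \<in> semiring_homs (assoc_semiring Q F) (assoc_semiring Q' F')"
  using assms induced_map_hom_iff by (cases u) (auto simp: pair_homs_def)

text \<open>No fibre is empty, since it contains its neutral element; hence the induced map
  determines \<open>f\<close> at every \<open>e\<close>. Extensionality then turns agreement on
  carriers into equality.\<close>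

lemma inj_on_induced_map: "inj_on (induced_map Q F) (pair_homs Q F Q' F')"
proof (rule inj_onI)
  fix u v assume u: "u \<in> pair_homs Q F Q' F'" and v: "v \<in> pair_homs Q F Q' F'"
    and eq: "induced_map Q F u = induced_map Q F v"
  obtain f \<alpha> f' \<alpha>' where uv: "u = (f, \<alpha>)" "v = (f', \<alpha>')" by (cases u, cases v) blast
  have f: "f \<in> extensional (carrier Q)" "f' \<in> extensional (carrier Q)"
    using u v by (auto simp: uv pair_homs_def intro: semiring_homsD(6))
  have "\<alpha> \<in> nat_transformations Q F (lax_precomp F' f)" "\<alpha>' \<in> nat_transformations Q F (lax_precomp F' f')"
    using u v by (auto simp: uv pair_homs_def)
  note \<alpha> = this[THEN nat_transformationsD(4)] this[THEN nat_transformationsD(2)]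
  have eqs: "f e = f' e" "\<alpha> e g = \<alpha>' e g" if "e \<in> carrier Q" "g \<in> carrier (fob F e)" for e g
    using fun_cong[OF eq, of "(e, g)"] that by (simp_all add: uv)
  have "f = f'"
    using eqs(1)[OF _ monoid.one_closed[OF Q.ob_monoid]] by (intro extensionalityI[OF f]) simp
  moreover have "\<alpha> = \<alpha>'"
    using eqs(2) \<alpha> by (intro extensionalityI[OF \<alpha>(1,2)] extensionalityI[OF \<alpha>(3,4)]) auto
  ultimately show "u = v" by (simp add: uv)
qed

text \<open>Each condition is tested on suitable pairs: sums and products under \<open>f\<close> on
  the pairs \<open>(e, 1)\<close>, additivity of \<open>\<alpha> e\<close> on sums within one fibre,
  naturality on the sum of \<open>(e, g)\<close> and \<open>(e', 1)\<close>. Monoidality of \<alpha>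
  comes from the criterion for induced maps, as \<open>h\<close> is the induced map.\<close>

lemma semiring_homs_from_induced_map:
  assumes h: "h \<in> semiring_homs (assoc_semiring Q F) (assoc_semiring Q' F')"
  shows "h \<in> induced_map Q F ` pair_homs Q F Q' F'"
proof -
  let ?S = "assoc_semiring Q F" and ?S' = "assoc_semiring Q' F'"
  note hD = semiring_homsD[OF h]
  define f where "f = (\<lambda>e\<in>carrier Q. fst (h (e, \<one>\<^bsub>fob F e\<^esub>)))"
  define \<alpha> where "\<alpha> = (\<lambda>e\<in>carrier Q. \<lambda>g\<in>carrier (fob F e). snd (h (e, g)))"
  have one: "\<one>\<^bsub>fob F e\<^esub> \<in> carrier (fob F e)" if "e \<in> carrier Q" for e
    using that by (intro monoid.one_closed Q.ob_monoid)
  have fst_add: "fst (x \<oplus>\<^bsub>?S'\<^esub> y) = fst x \<oplus>\<^bsub>Q'\<^esub> fst y" for x y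
    by (cases x; cases y) simp
  have fst_mult: "fst (x \<otimes>\<^bsub>?S'\<^esub> y) = fst x \<otimes>\<^bsub>Q'\<^esub> fst y" for x y
    by (cases x; cases y) simp
  have fst_closed: "fst (h (e, g)) \<in> carrier Q'" if "e \<in> carrier Q" "g \<in> carrier (fob F e)" for e g
    using hD(1)[of "(e, g)"] that by (cases "h (e, g)") simp
  \<comment> \<open>\<open>(e, g)\<close> and the idempotent \<open>(e, 1)\<close> are multiples of each other in the additive monoid,
    so their images lie over the same element.\<close>
  have fst_h: "fst (h (e, g)) = f e" if c: "e \<in> carrier Q" "g \<in> carrier (fob F e)" for e g
  proof -
    interpret E: comm_group "fob F e" by (rule Q.ob_comm_group) (fact c)
    let ?g' = "inv\<^bsub>fob F e\<^esub> g"
    note same = Q.assoc_add_same[OF c(1)]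
    have "fst (h (e, g)) = fst (h (e, g)) \<oplus>\<^bsub>Q'\<^esub> fst (h (e, \<one>\<^bsub>fob F e\<^esub>))"
      using hD(3)[of "(e, g)" "(e, \<one>\<^bsub>fob F e\<^esub>)"] c
      by (simp add: same fst_add[symmetric] del: assoc_semiring_simps)
    moreover have "fst (h (e, \<one>\<^bsub>fob F e\<^esub>)) = fst (h (e, g)) \<oplus>\<^bsub>Q'\<^esub> fst (h (e, ?g'))"
      using hD(3)[of "(e, g)" "(e, ?g')"] c
      by (simp add: same fst_add[symmetric] del: assoc_semiring_simps)
    moreover have "fst (h (e, g)) \<oplus>\<^bsub>Q'\<^esub> (fst (h (e, g)) \<oplus>\<^bsub>Q'\<^esub> fst (h (e, ?g'))) =
        fst (h (e, g)) \<oplus>\<^bsub>Q'\<^esub> fst (h (e, ?g'))"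
      using c by (simp add: fst_closed Q'.a_assoc[symmetric] Q'.idem)
    ultimately show ?thesis using c by (simp add: f_def)
  qed
  have h_eq: "h (e, g) = (f e, \<alpha> e g)" if "e \<in> carrier Q" "g \<in> carrier (fob F e)" for e g
    using fst_h[OF that] that by (simp add: \<alpha>_def prod_eq_iff)
  have closed: "f e \<in> carrier Q'" "\<alpha> e g \<in> carrier (fob F' (f e))"
    if "e \<in> carrier Q" "g \<in> carrier (fob F e)" for e g
    using hD(1)[of "(e, g)"] that by (simp_all add: h_eq)
  have f_closed: "f e \<in> carrier Q'" if "e \<in> carrier Q" for e
    using closed(1)[OF that one[OF that]] .
  have f: "f \<in> semiring_homs Q Q'"
  proof (rule semiring_homsI)
    show "f \<one>\<^bsub>Q\<^esub> = \<one>\<^bsub>Q'\<^esub>" using hD(4) by (simp add: h_eq Q.fun1_closed)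
    show "f \<zero>\<^bsub>Q\<^esub> = \<zero>\<^bsub>Q'\<^esub>" using hD(5) by (simp add: h_eq one)
    show "f \<in> extensional (carrier Q)" by (simp add: f_def)
    show "f e \<in> carrier Q'" if "e \<in> carrier Q" for e using that by (rule f_closed)
    fix e e' assume c: "e \<in> carrier Q" "e' \<in> carrier Q"
    show "f (e \<otimes>\<^bsub>Q\<^esub> e') = f e \<otimes>\<^bsub>Q'\<^esub> f e'"
      using hD(2)[of "(e, \<one>\<^bsub>fob F e\<^esub>)" "(e', \<one>\<^bsub>fob F e'\<^esub>)"] c
      by (simp add: h_eq one Q.lax_mult_one)
    show "f (e \<oplus>\<^bsub>Q\<^esub> e') = f e \<oplus>\<^bsub>Q'\<^esub> f e'"
      using hD(3)[of "(e, \<one>\<^bsub>fob F e\<^esub>)" "(e', \<one>\<^bsub>fob F e'\<^esub>)"] c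
      by (simp add: h_eq one Q.assoc_add_one[OF c one[OF c(1)]] Q.far_one Q.le_add1 fst_add
          del: assoc_semiring_simps(2)) simp
  qed
  have \<alpha>_hom: "\<alpha> e \<in> hom (fob F e) (fob F' (f e))" if e: "e \<in> carrier Q" for e
  proof (rule homI)
    interpret E: comm_group "fob F e" by (rule Q.ob_comm_group) (fact e)
    show "\<alpha> e g \<in> carrier (fob F' (f e))" if "g \<in> carrier (fob F e)" for g
      using closed(2)[OF e that] .
    fix g g' assume g: "g \<in> carrier (fob F e)" "g' \<in> carrier (fob F e)"
    show "\<alpha> e (g \<otimes>\<^bsub>fob F e\<^esub> g') = \<alpha> e g \<otimes>\<^bsub>fob F' (f e)\<^esub> \<alpha> e g'"
      using hD(3)[of "(e, g)" "(e, g')"] e g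
      by (simp add: Q.assoc_add_same Q'.assoc_add_same h_eq closed f_closed del: assoc_semiring_simps(2))
  qed
  have \<alpha>: "\<alpha> \<in> nat_transformations Q F (lax_precomp F' f)"
  proof -
    have "\<alpha> e' (far F e e' g) = far F' (f e) (f e') (\<alpha> e g)"
      if le: "idem_le Q e e'" and g: "g \<in> carrier (fob F e)" for e e' g
    proof -
      have c: "e \<in> carrier Q" "e' \<in> carrier Q" "e \<oplus>\<^bsub>Q\<^esub> e' = e'" using le by (auto simp: idem_le_def)
      have fe: "f e \<oplus>\<^bsub>Q'\<^esub> f e' = f e'" using semiring_homs_le[OF f le] by (simp add: idem_le_def)
      have \<alpha>1: "\<alpha> e' \<one>\<^bsub>fob F e'\<^esub> = \<one>\<^bsub>fob F' (f e')\<^esub>"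
        using hom_one[OF \<alpha>_hom Q.ob_group Q'.ob_group] c f_closed by simp
      have "h ((e, g) \<oplus>\<^bsub>?S\<^esub> (e', \<one>\<^bsub>fob F e'\<^esub>)) = h (e, g) \<oplus>\<^bsub>?S'\<^esub> h (e', \<one>\<^bsub>fob F e'\<^esub>)"
        using c g by (intro hD(3)) (simp_all add: one)
      then show ?thesis
        using c g Q.far_closed[OF le g]
        by (simp add: Q.assoc_add_one Q'.assoc_add_one h_eq one closed f_closed fe \<alpha>1
            del: assoc_semiring_simps(2))
    qed
    moreover have "\<alpha> \<in> extensional (carrier Q)"
      "\<And>e. e \<in> carrier Q \<Longrightarrow> \<alpha> e \<in> extensional (carrier (fob F e))"
      by (simp_all add: \<alpha>_def)
    ultimately show ?thesis
      using \<alpha>_hom by (simp add: nat_transformations_def lax_precomp_def)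
  qed
  have "h = induced_map Q F (f, \<alpha>)"
    by (rule extensionalityI[OF hD(6) induced_map_extensional])
      (auto elim!: assoc_semiring_cases simp: h_eq)
  then show ?thesis
    using induced_map_hom_iff[OF f \<alpha>] h f \<alpha> by (auto simp: pair_homs_def)
qed

lemma bij_betw_induced_map:
  "bij_betw (induced_map Q F) (pair_homs Q F Q' F')
    (semiring_homs (assoc_semiring Q F) (assoc_semiring Q' F'))"
  unfolding bij_betw_def
  using inj_on_induced_map induced_map_hom semiring_homs_from_induced_map by blast

end


section \<open>Identities, composition and isomorphisms\<close>

lemma semiring_homs_id: "(\<lambda>x\<in>carrier R. x) \<in> semiring_homs R R" if "semiring R"
proof -
  interpret semiring R by fact
  show ?thesis by (rule semiring_homsI) simp_all
qed

lemma semiring_homs_compose: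
  assumes "semiring R" "h \<in> semiring_homs R S" "k \<in> semiring_homs S T"
  shows "compose (carrier R) k h \<in> semiring_homs R T"
proof -
  interpret semiring R by fact
  show ?thesis
    by (rule semiring_homsI)
      (simp_all add: compose_eq semiring_homsD[OF assms(2)] semiring_homsD[OF assms(3)])
qed

lemma semiring_homs_inv_into:
  assumes "semiring R" "semiring S" "h \<in> semiring_homs R S" and bij: "bij_betw h (carrier R) (carrier S)"
  shows "(\<lambda>y\<in>carrier S. inv_into (carrier R) h y) \<in> semiring_homs S R"
proof -
  interpret R: semiring R by fact
  interpret S: semiring S by fact
  note h = semiring_homsD[OF assms(3)]
  let ?k = "inv_into (carrier R) h"
  have k: "?k y \<in> carrier R" "h (?k y) = y" if "y \<in> carrier S" for y
    using that bij by (auto simp: bij_betw_def inv_into_into f_inv_into_f)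
  have kI: "?k y = x" if "x \<in> carrier R" "h x = y" for x y
    using that bij by (auto simp: bij_betw_def)
  show ?thesis
  proof (rule semiring_homsI)
    fix x y assume xy: "x \<in> carrier S" "y \<in> carrier S"
    then show "(\<lambda>y\<in>carrier S. ?k y) (x \<otimes>\<^bsub>S\<^esub> y) = (\<lambda>y\<in>carrier S. ?k y) x \<otimes>\<^bsub>R\<^esub> (\<lambda>y\<in>carrier S. ?k y) y"
      and "(\<lambda>y\<in>carrier S. ?k y) (x \<oplus>\<^bsub>S\<^esub> y) = (\<lambda>y\<in>carrier S. ?k y) x \<oplus>\<^bsub>R\<^esub> (\<lambda>y\<in>carrier S. ?k y) y"
      by (simp_all add: kI k h(2,3))
  qed (simp_all add: k kI h(4,5))
qed

text \<open>Monoidality is not computed on tensors: the induced map is the identity of the semiring,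
  hence a homomorphism, and the criterion for induced maps applies.\<close>

lemma (in lax_monoidal) pair_id:
  shows pair_id_in_pair_homs: "pair_id Q F \<in> pair_homs Q F Q F"
    and induced_map_pair_id: "induced_map Q F (pair_id Q F) = (\<lambda>x\<in>carrier (assoc_semiring Q F). x)"
proof -
  interpret P: lax_monoidal_pair Q F Q F ..
  let ?f = "\<lambda>e\<in>carrier Q. e" and ?\<alpha> = "\<lambda>e\<in>carrier Q. \<lambda>x\<in>carrier (fob F e). x"
  show map: "induced_map Q F (pair_id Q F) = (\<lambda>x\<in>carrier (assoc_semiring Q F). x)"
    by (rule extensionalityI[OF induced_map_extensional restrict_extensional])
      (auto elim!: assoc_semiring_cases simp: pair_id_def)
  have f: "?f \<in> semiring_homs Q Q" by (rule semiring_homs_id[OF semiring_axioms])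
  have nat: "?\<alpha> \<in> nat_transformations Q F (lax_precomp F ?f)"
    by (auto simp: nat_transformations_def lax_precomp_def idem_le_def far_closed hom_def monoid.m_closed ob_monoid)
  then show "pair_id Q F \<in> pair_homs Q F Q F"
    using P.induced_map_hom_iff[OF f nat] map f semiring_homs_id[OF semiring_assoc_semiring]
    by (simp add: pair_homs_def pair_id_def)
qed

lemma pair_comp:
  assumes "lax_monoidal Q F" "lax_monoidal Q' F'" "lax_monoidal Q'' F''"
    and u: "u \<in> pair_homs Q F Q' F'" and v: "v \<in> pair_homs Q' F' Q'' F''"
  shows pair_comp_in_pair_homs: "pair_comp Q F v u \<in> pair_homs Q F Q'' F''"
    and induced_map_pair_comp: "induced_map Q F (pair_comp Q F v u) =
      compose (carrier (assoc_semiring Q F)) (induced_map Q' F' v) (induced_map Q F u)"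
proof -
  interpret L: lax_monoidal Q F by fact
  interpret L': lax_monoidal Q' F' by fact
  interpret L'': lax_monoidal Q'' F'' by fact
  interpret P: lax_monoidal_pair Q F Q' F' ..
  interpret P': lax_monoidal_pair Q' F' Q'' F'' ..
  interpret P'': lax_monoidal_pair Q F Q'' F'' ..
  obtain f \<alpha> f' \<alpha>' where uv: "u = (f, \<alpha>)" "v = (f', \<alpha>')" by (cases u, cases v) blast
  have f: "f \<in> semiring_homs Q Q'" and f': "f' \<in> semiring_homs Q' Q''"
    and \<alpha>: "\<alpha> \<in> nat_transformations Q F (lax_precomp F' f)"
    and \<alpha>': "\<alpha>' \<in> nat_transformations Q' F' (lax_precomp F'' f')"
    using u v by (auto simp: uv pair_homs_def)
  note fD = semiring_homsD[OF f] and \<alpha>D = nat_transformationsD[OF \<alpha>]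
    and \<alpha>'D = nat_transformationsD[OF \<alpha>']
  have \<alpha>_closed: "\<alpha> e g \<in> carrier (fob F' (f e))" if "e \<in> carrier Q" "g \<in> carrier (fob F e)" for e g
    using hom_in_carrier[OF \<alpha>D(1)] that .
  show map: "induced_map Q F (pair_comp Q F v u) =
      compose (carrier (assoc_semiring Q F)) (induced_map Q' F' v) (induced_map Q F u)"
    by (rule extensionalityI[OF induced_map_extensional compose_extensional])
      (auto elim!: assoc_semiring_cases simp: pair_comp_def compose_eq uv fD(1) \<alpha>_closed)
  let ?f = "compose (carrier Q) f' f"
  let ?\<alpha> = "\<lambda>e\<in>carrier Q. compose (carrier (fob F e)) (\<alpha>' (f e)) (\<alpha> e)"
  have comp: "?f \<in> semiring_homs Q Q''"
    by (rule semiring_homs_compose[OF L.semiring_axioms f f'])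
  have nat: "?\<alpha> \<in> nat_transformations Q F (lax_precomp F'' ?f)"
  proof -
    have "compose (carrier (fob F e)) (\<alpha>' (f e)) (\<alpha> e) \<in> hom (fob F e) (fob F'' (f' (f e)))"
      if "e \<in> carrier Q" for e
      using hom_comp[OF \<alpha>D(1)[OF that] \<alpha>'D(1)[OF fD(1)[OF that]]] L.ob_monoid[OF that]
      by (auto simp: hom_def compose_def monoid.m_closed Pi_iff)
    moreover have "\<alpha>' (f e') (\<alpha> e' (far F e e' g)) = far F'' (f' (f e)) (f' (f e')) (\<alpha>' (f e) (\<alpha> e g))"
      if "idem_le Q e e'" "g \<in> carrier (fob F e)" for e e' g
      using that \<alpha>'D(3)[OF semiring_homs_le[OF f that(1)] \<alpha>_closed[OF _ that(2)]]
      by (simp add: \<alpha>D(3) idem_le_def)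
    ultimately show ?thesis
      by (auto simp: nat_transformations_def lax_precomp_def compose_eq L.far_closed idem_le_def)
  qed
  \<comment> \<open>The pair induces the composite of two semiring homomorphisms, and monoidality is
    read off from this.\<close>
  then show "pair_comp Q F v u \<in> pair_homs Q F Q'' F''"
    using P''.induced_map_hom_iff[OF comp nat] map comp
      semiring_homs_compose[OF L.semiring_assoc_semiring P.induced_map_hom[OF u] P'.induced_map_hom[OF v]]
    by (simp add: pair_homs_def pair_comp_def uv)
qed

text \<open>A formal consequence of full faithfulness and functoriality: the inverse of a bijective
  homomorphism is again induced by a pair, and the composites of the two pairs are identities
  because they induce identities.\<close>

lemma (in lax_monoidal_pair) semiring_isomorphic_iff:
  "semiring_isomorphic (assoc_semiring Q F) (assoc_semiring Q' F') \<longleftrightarrow> pair_isomorphic Q F Q' F'"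
proof -
  interpret R: lax_monoidal_pair Q' F' Q F ..
  interpret QQ: lax_monoidal_pair Q F Q F ..
  interpret QQ': lax_monoidal_pair Q' F' Q' F' ..
  let ?S = "assoc_semiring Q F" and ?S' = "assoc_semiring Q' F'"
  note comp = pair_comp[OF Q.lax_monoidal_axioms Q'.lax_monoidal_axioms Q.lax_monoidal_axioms]
    and comp' = pair_comp[OF Q'.lax_monoidal_axioms Q.lax_monoidal_axioms Q'.lax_monoidal_axioms]
  show ?thesis
  proof
    assume "semiring_isomorphic ?S ?S'"
    then obtain h where h: "h \<in> semiring_homs ?S ?S'" and bij: "bij_betw h (carrier ?S) (carrier ?S')"
      unfolding semiring_isomorphic_def by blast
    let ?k = "\<lambda>y\<in>carrier ?S'. inv_into (carrier ?S) h y"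
    have "?k \<in> semiring_homs ?S' ?S"
      by (rule semiring_homs_inv_into[OF Q.semiring_assoc_semiring Q'.semiring_assoc_semiring h bij])
    then obtain u v where u: "u \<in> pair_homs Q F Q' F'" "induced_map Q F u = h"
      and v: "v \<in> pair_homs Q' F' Q F" "induced_map Q' F' v = ?k"
      using semiring_homs_from_induced_map[OF h] R.semiring_homs_from_induced_map by force
    have "pair_comp Q F v u = pair_id Q F"
      using comp[OF u(1) v(1)] compose_inv_into_id[OF bij]
      by (intro inj_onD[OF QQ.inj_on_induced_map])
        (simp_all add: u(2) v(2) Q.pair_id_in_pair_homs Q.induced_map_pair_id)
    moreover have "pair_comp Q' F' u v = pair_id Q' F'"
      using comp'[OF v(1) u(1)] compose_id_inv_into[of h "carrier ?S" "carrier ?S'"] bij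
      by (intro inj_onD[OF QQ'.inj_on_induced_map])
        (simp_all add: u(2) v(2) Q'.pair_id_in_pair_homs Q'.induced_map_pair_id bij_betw_def)
    ultimately show "pair_isomorphic Q F Q' F'"
      unfolding pair_isomorphic_def using u(1) v(1) by blast
  next
    assume "pair_isomorphic Q F Q' F'"
    then obtain u v where u: "u \<in> pair_homs Q F Q' F'" and v: "v \<in> pair_homs Q' F' Q F"
      and id: "pair_comp Q F v u = pair_id Q F" "pair_comp Q' F' u v = pair_id Q' F'"
      unfolding pair_isomorphic_def by blast
    note h = induced_map_hom[OF u] and k = R.induced_map_hom[OF v]
    have "induced_map Q' F' v (induced_map Q F u x) = x" if "x \<in> carrier ?S" for x
      using fun_cong[OF comp(2)[OF u v], of x] that
      by (simp add: id Q.induced_map_pair_id compose_eq)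
    moreover have "induced_map Q F u (induced_map Q' F' v x) = x" if "x \<in> carrier ?S'" for x
      using fun_cong[OF comp'(2)[OF v u], of x] that
      by (simp add: id Q'.induced_map_pair_id compose_eq)
    ultimately have "bij_betw (induced_map Q F u) (carrier ?S) (carrier ?S')"
      using semiring_homsD(1)[OF h] semiring_homsD(1)[OF k]
      by (intro bij_betwI[where g = "induced_map Q' F' v"]) auto
    then show "semiring_isomorphic ?S ?S'"
      using h by (auto simp: semiring_isomorphic_def)
  qed
qed


section \<open>The lax monoidal functor of an inverse semiring\<close>

locale inverse_semiring_struct = semiring R for R :: "'r ring" (structure) +
  assumes unique_inverse:
    "x \<in> carrier R \<Longrightarrow> \<exists>!y. y \<in> carrier R \<and> x \<oplus> y \<oplus> x = x \<and> y \<oplus> x \<oplus> y = y"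
begin

section \<open>Calculus of additive inverses\<close>

definition neg :: "'r \<Rightarrow> 'r" where
  "neg x = (THE y. y \<in> carrier R \<and> x \<oplus> y \<oplus> x = x \<and> y \<oplus> x \<oplus> y = y)"

lemma neg:
  assumes "x \<in> carrier R"
  shows neg_closed [simp]: "neg x \<in> carrier R"
    and add_neg_add: "x \<oplus> neg x \<oplus> x = x" and neg_add_neg: "neg x \<oplus> x \<oplus> neg x = neg x"
  using theI'[OF unique_inverse[OF assms]] unfolding neg_def by blast+

lemma neg_eqI:
  assumes "x \<in> carrier R" "y \<in> carrier R" "x \<oplus> y \<oplus> x = x" "y \<oplus> x \<oplus> y = y"
  shows "neg x = y"
  using unique_inverse[OF assms(1)] neg[OF assms(1)] assms(2-) by blast

lemma neg_neg: "x \<in> carrier R \<Longrightarrow> neg (neg x) = x"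
  by (intro neg_eqI) (simp_all add: neg)

lemma neg_idem: "e \<in> carrier R \<Longrightarrow> e \<oplus> e = e \<Longrightarrow> neg e = e"
  by (intro neg_eqI) simp_all

lemma neg_add:
  assumes "x \<in> carrier R" "y \<in> carrier R"
  shows "neg (x \<oplus> y) = neg x \<oplus> neg y"
proof (rule neg_eqI)
  have "x \<oplus> y \<oplus> (neg x \<oplus> neg y) \<oplus> (x \<oplus> y) = (x \<oplus> neg x \<oplus> x) \<oplus> (y \<oplus> neg y \<oplus> y)"
    using assms by (simp add: a_ac)
  then show "x \<oplus> y \<oplus> (neg x \<oplus> neg y) \<oplus> (x \<oplus> y) = x \<oplus> y"
    using assms by (simp add: add_neg_add)
  have "neg x \<oplus> neg y \<oplus> (x \<oplus> y) \<oplus> (neg x \<oplus> neg y) = (neg x \<oplus> x \<oplus> neg x) \<oplus> (neg y \<oplus> y \<oplus> neg y)"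
    using assms by (simp add: a_ac)
  then show "neg x \<oplus> neg y \<oplus> (x \<oplus> y) \<oplus> (neg x \<oplus> neg y) = neg x \<oplus> neg y"
    using assms by (simp add: neg_add_neg)
qed (use assms in simp_all)

text \<open>By distributivity \<open>x y + neg x y + x y = (x + neg x + x) y = x y\<close>. The
  other equation and the other factor work alike, so uniqueness of the inverse identifies both
  products with \<open>neg (x y)\<close>.\<close>

lemma neg_mult:
  assumes "x \<in> carrier R" "y \<in> carrier R"
  shows "neg (x \<otimes> y) = neg x \<otimes> y" and "neg (x \<otimes> y) = x \<otimes> neg y"
  using assms by (auto intro!: neg_eqI simp: l_distr[symmetric] r_distr[symmetric] add_neg_add neg_add_neg)

text \<open>\<open>supp x = x + x\<^sup>*\<close> is the additive idempotent over which \<open>x\<close> lives: \<open>F e = supp -` {e}\<close>.\<close>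

definition supp :: "'r \<Rightarrow> 'r" where
  "supp x = x \<oplus> neg x"

lemma supp_closed [simp]: "x \<in> carrier R \<Longrightarrow> supp x \<in> carrier R"
  by (simp add: supp_def)

lemma add_supp: "x \<in> carrier R \<Longrightarrow> x \<oplus> supp x = x"
  using add_neg_add[of x] by (simp add: supp_def a_ac)

lemma supp_idem: "x \<in> carrier R \<Longrightarrow> supp x \<oplus> supp x = supp x"
  using add_neg_add[of x] by (simp add: supp_def a_assoc[symmetric])

lemma supp_of_idem: "e \<in> carrier R \<Longrightarrow> e \<oplus> e = e \<Longrightarrow> supp e = e"
  by (simp add: supp_def neg_idem)

lemma supp_neg: "x \<in> carrier R \<Longrightarrow> supp (neg x) = supp x"
  by (simp add: supp_def neg_neg a_comm)

lemma supp_add: "x \<in> carrier R \<Longrightarrow> y \<in> carrier R \<Longrightarrow> supp (x \<oplus> y) = supp x \<oplus> supp y"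
  by (simp add: supp_def neg_add a_ac)

lemma mult_supp:
  assumes "x \<in> carrier R" "y \<in> carrier R"
  shows "x \<otimes> supp y = supp (x \<otimes> y)" and "supp x \<otimes> y = supp (x \<otimes> y)"
  using assms neg_mult[OF assms] by (simp_all add: supp_def l_distr r_distr)

text \<open>Supports are pulled out of a product one factor at a time, and a support is its own
  support. Consequently the product maps \<open>fiber X\<close> and \<open>fiber Y\<close> into
  \<open>fiber (X \<otimes> Y)\<close>.\<close>

lemma supp_mult:
  assumes "x \<in> carrier R" "y \<in> carrier R"
  shows "supp (x \<otimes> y) = supp x \<otimes> supp y"
  using assms by (simp add: mult_supp supp_of_idem supp_idem)

text \<open>A product with an additive idempotent is itself idempotent, hence its own support, so
  the other factor counts only through its support. This removes the cross terms in
  naturality.\<close>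

lemma mult_idem:
  assumes "x \<in> carrier R" "e \<in> carrier R" "e \<oplus> e = e"
  shows "x \<otimes> e = supp x \<otimes> e" and "e \<otimes> x = e \<otimes> supp x"
  using assms mult_supp[of x e] mult_supp[of e x] by (simp_all add: supp_of_idem)

text \<open>The unit cannot be taken over from \<open>R\<close>: in a ring, 0 is the only additive
  idempotent. The element \<open>supp \<one>\<close> works since
  \<open>supp \<one> \<otimes> e = supp e = e\<close>.\<close>

definition idempotents :: "'r ring" where
  "idempotents = \<lparr> carrier = {e \<in> carrier R. e \<oplus> e = e}, monoid.mult = (\<otimes>), monoid.one = supp \<one>,
     ring.zero = \<zero>, ring.add = (\<oplus>) \<rparr>"

definition fiber :: "'r \<Rightarrow> 'r monoid" where
  "fiber e = \<lparr> carrier = {x \<in> carrier R. supp x = e}, monoid.mult = (\<oplus>), monoid.one = e \<rparr>"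

text \<open>The operation of \<open>fiber (supp \<one>)\<close> is the addition of \<open>R\<close>,
  so the power defining \<iota> is the integer multiple \<open>n 1\<close>, with
  \<open>neg \<one>\<close> used for negative \<open>n\<close>.\<close>

definition fiber_functor :: "('r, 'r) lax_functor" where
  "fiber_functor = \<lparr> fob = fiber, far = (\<lambda>e e' x. x \<oplus> e'),
     fun1 = (\<lambda>n. \<one> [^]\<^bsub>fiber (supp \<one>)\<^esub> n),
     fmu = (\<lambda>X Y. tensor_lift (fiber X) (fiber Y) (fiber (X \<otimes> Y)) (\<otimes>)) \<rparr>"

section \<open>Idempotents and fibres as a lax monoidal functor\<close>

lemma idempotents_simps [simp]:
  "e \<in> carrier idempotents \<longleftrightarrow> e \<in> carrier R \<and> e \<oplus> e = e"
  "x \<otimes>\<^bsub>idempotents\<^esub> y = x \<otimes> y" "x \<oplus>\<^bsub>idempotents\<^esub> y = x \<oplus> y"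
  "\<one>\<^bsub>idempotents\<^esub> = supp \<one>" "\<zero>\<^bsub>idempotents\<^esub> = \<zero>"
  by (simp_all add: idempotents_def)

lemma fiber_simps [simp]:
  "x \<in> carrier (fiber e) \<longleftrightarrow> x \<in> carrier R \<and> supp x = e"
  "x \<otimes>\<^bsub>fiber e\<^esub> y = x \<oplus> y" "\<one>\<^bsub>fiber e\<^esub> = e"
  by (simp_all add: fiber_def)

lemma fiber_functor_simps [simp]:
  "fob fiber_functor = fiber" "far fiber_functor e e' = (\<lambda>x. x \<oplus> e')"
  "fun1 fiber_functor n = \<one> [^]\<^bsub>fiber (supp \<one>)\<^esub> n"
  "fmu fiber_functor X Y = tensor_lift (fiber X) (fiber Y) (fiber (X \<otimes> Y)) (\<otimes>)"
  by (simp_all add: fiber_functor_def)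

lemma idem_le_idempotents:
  "idem_le idempotents e e' \<longleftrightarrow>
    e \<in> carrier R \<and> e \<oplus> e = e \<and> e' \<in> carrier R \<and> e' \<oplus> e' = e' \<and> e \<oplus> e' = e'"
  by (auto simp: idem_le_def)

lemma idem_mult_closed:
  "x \<in> carrier R \<Longrightarrow> x \<oplus> x = x \<Longrightarrow> y \<in> carrier R \<Longrightarrow> x \<otimes> y \<oplus> x \<otimes> y = x \<otimes> y"
  by (simp add: l_distr[symmetric])

lemma idem_semiring_idempotents: "idem_semiring idempotents"
proof -
  have add: "x \<oplus> (y \<oplus> (x \<oplus> y)) = x \<oplus> y"
    if "x \<in> carrier R" "x \<oplus> x = x" "y \<in> carrier R" "y \<oplus> y = y" for x y
  proof -
    have "x \<oplus> (y \<oplus> (x \<oplus> y)) = (x \<oplus> x) \<oplus> (y \<oplus> y)" using that(1,3) by (simp add: a_ac)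
    then show ?thesis by (simp add: that)
  qed
  have "semiring idempotents"
    by (intro semiring.intro semiring_axioms.intro abelian_monoidI monoidI)
      (auto simp: add idem_mult_closed a_assoc m_assoc l_distr r_distr supp_idem mult_supp
        supp_of_idem intro: a_comm)
  then show ?thesis by (simp add: idem_semiring_def)
qed

text \<open>The neutral law is \<open>x + supp x = x\<close>. The inverse \<open>neg x\<close> stays
  in the fibre because \<open>x\<close> and \<open>neg x\<close> have the same support, which is
  also their sum.\<close>

lemma comm_group_fiber:
  assumes "e \<in> carrier R" "e \<oplus> e = e"
  shows "comm_group (fiber e)"
proof (rule comm_groupI)
  fix x assume "x \<in> carrier (fiber e)"
  then have x: "x \<in> carrier R" "supp x = e" by simp_all
  show "\<one>\<^bsub>fiber e\<^esub> \<otimes>\<^bsub>fiber e\<^esub> x = x" using add_supp[OF x(1)] x assms by (simp add: a_comm)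
  show "\<exists>y\<in>carrier (fiber e). y \<otimes>\<^bsub>fiber e\<^esub> x = \<one>\<^bsub>fiber e\<^esub>"
    using x supp_neg[OF x(1)] by (intro bexI[of _ "neg x"]) (simp_all add: supp_def a_comm)
qed (use assms in \<open>auto simp: supp_add supp_of_idem a_assoc intro: a_comm\<close>)

lemma biadditive_fiber_mult:
  assumes "X \<in> carrier R" "X \<oplus> X = X" "Y \<in> carrier R" "Y \<oplus> Y = Y"
  shows "biadditive (fiber X) (fiber Y) (fiber (X \<otimes> Y)) (\<otimes>)"
  by (rule biadditiveI) (auto simp: l_distr r_distr supp_mult)

text \<open>On elements \<mu> is the product of \<open>R\<close>; with this the tensor product
  disappears from the remaining computations.\<close>

lemma lax_mult_fiber_functor:
  assumes "X \<in> carrier R" "X \<oplus> X = X" "Y \<in> carrier R" "Y \<oplus> Y = Y"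
    and "x \<in> carrier R" "supp x = X" "y \<in> carrier R" "supp y = Y"
  shows "lax_mult fiber_functor X Y x y = x \<otimes> y"
  using assms
  by (simp add: tensor_lift_pure[OF comm_group_fiber comm_group_fiber comm_group_fiber biadditive_fiber_mult]
      l_distr[symmetric])

lemma lax_monoidal_fiber_functor: "lax_monoidal_functor idempotents fiber_functor"
proof -
  interpret U: comm_group "fiber (supp \<one>)" by (rule comm_group_fiber) (simp_all add: supp_idem)
  have pow1: "\<one> [^]\<^bsub>fiber (supp \<one>)\<^esub> (1::int) = \<one>" by (rule U.int_pow_1) simp
  have far: "(\<lambda>x. x \<oplus> e') \<in> hom (fiber e) (fiber e')" if "idem_le idempotents e e'" for e e'
  proof (rule homI)
    have e: "e \<in> carrier R" "e' \<in> carrier R" "e' \<oplus> e' = e'" "e \<oplus> e' = e'"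
      using that by (simp_all add: idem_le_idempotents)
    show "x \<oplus> e' \<in> carrier (fiber e')" if "x \<in> carrier (fiber e)" for x
      using that e by (simp add: supp_add supp_of_idem)
    fix x y assume xy: "x \<in> carrier (fiber e)" "y \<in> carrier (fiber e)"
    \<comment> \<open>Idempotence supplies a second copy of \<open>e'\<close>, one for each
      summand.\<close>
    have "x \<oplus> y \<oplus> (e' \<oplus> e') = x \<oplus> e' \<oplus> (y \<oplus> e')"
      using xy e(1,2) by (simp add: a_ac)
    then show "x \<otimes>\<^bsub>fiber e\<^esub> y \<oplus> e' = (x \<oplus> e') \<otimes>\<^bsub>fiber e'\<^esub> (y \<oplus> e')"
      by (simp add: e(3))
  qed
  \<comment> \<open>The cross terms \<open>x Y'\<close> and \<open>X' y\<close> have an idempotent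
    factor, so they equal \<open>X Y'\<close> and \<open>X' Y\<close>; both lie below
    \<open>X' Y'\<close> and disappear into it.\<close>
  have natural: "x \<otimes> y \<oplus> X' \<otimes> Y' = (x \<oplus> X') \<otimes> (y \<oplus> Y')"
    if X: "idem_le idempotents X X'" and Y: "idem_le idempotents Y Y'"
      and x: "x \<in> carrier R" "supp x = X" and y: "y \<in> carrier R" "supp y = Y" for X X' Y Y' x y
  proof -
    have c: "X \<in> carrier R" "X' \<in> carrier R" "Y \<in> carrier R" "Y' \<in> carrier R"
      and i: "X' \<oplus> X' = X'" "Y' \<oplus> Y' = Y'" and le: "X \<oplus> X' = X'" "Y \<oplus> Y' = Y'"
      using X Y by (simp_all add: idem_le_idempotents)
    have "(x \<oplus> X') \<otimes> (y \<oplus> Y') = x \<otimes> y \<oplus> (x \<otimes> Y' \<oplus> (X' \<otimes> y \<oplus> X' \<otimes> Y'))"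
      using c x(1) y(1) by (simp add: l_distr r_distr a_ac)
    also have "X' \<otimes> y \<oplus> X' \<otimes> Y' = X' \<otimes> Y'"
      using c y by (simp add: mult_idem(2)[OF y(1) c(2) i(1)] r_distr[symmetric] le)
    also have "x \<otimes> Y' \<oplus> X' \<otimes> Y' = X' \<otimes> Y'"
      using c x by (simp add: mult_idem(1)[OF x(1) c(4) i(2)] l_distr[symmetric] le)
    finally show ?thesis ..
  qed
  have functor_Ab: "functor_to_Ab idempotents fiber_functor"
    using far
    by (auto simp: functor_to_Ab_def comm_group_fiber add_supp idem_le_idempotents a_assoc)
  have fun1: "(\<lambda>n. \<one> [^]\<^bsub>fiber (supp \<one>)\<^esub> n) \<in> hom integer_group (fiber (supp \<one>))"
    by (rule U.hom_integer_group_pow) simp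
  show ?thesis
    unfolding lax_monoidal_functor_iff[OF idem_semiring_idempotents]
  proof (intro conjI ballI allI impI functor_Ab)
    show "fun1 fiber_functor \<in> hom integer_group (fob fiber_functor \<one>\<^bsub>idempotents\<^esub>)"
      using fun1 by (simp add: fiber_functor_def)
    show "fmu fiber_functor X Y
        \<in> hom (tensor (fob fiber_functor X) (fob fiber_functor Y)) (fob fiber_functor (X \<otimes>\<^bsub>idempotents\<^esub> Y))"
      if "X \<in> carrier idempotents" "Y \<in> carrier idempotents" for X Y
      using that
      by (simp add: tensor_lift_hom comm_group_fiber biadditive_fiber_mult idem_mult_closed)
    show "far fiber_functor (X \<otimes>\<^bsub>idempotents\<^esub> Y) (X' \<otimes>\<^bsub>idempotents\<^esub> Y') (lax_mult fiber_functor X Y a b) =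
        lax_mult fiber_functor X' Y' (far fiber_functor X X' a) (far fiber_functor Y Y' b)"
      if X: "idem_le idempotents X X'" and Y: "idem_le idempotents Y Y'"
        and a: "a \<in> carrier (fob fiber_functor X)" and b: "b \<in> carrier (fob fiber_functor Y)"
      for X X' Y Y' a b
    proof -
      have "a \<oplus> X' \<in> carrier (fiber X')" "b \<oplus> Y' \<in> carrier (fiber Y')"
        using hom_in_carrier[OF far[OF X]] hom_in_carrier[OF far[OF Y]] a b by simp_all
      then have "lax_mult fiber_functor X' Y' (a \<oplus> X') (b \<oplus> Y') = (a \<oplus> X') \<otimes> (b \<oplus> Y')"
        using X Y by (intro lax_mult_fiber_functor) (simp_all add: idem_le_idempotents)
      moreover have "lax_mult fiber_functor X Y a b = a \<otimes> b"
        using X Y a b by (intro lax_mult_fiber_functor) (simp_all add: idem_le_idempotents)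
      ultimately show ?thesis
        using natural[OF X Y] a b by (simp del: fiber_functor_simps(4))
    qed
    show "lax_mult fiber_functor (X \<otimes>\<^bsub>idempotents\<^esub> Y) Z (lax_mult fiber_functor X Y a b) c =
        lax_mult fiber_functor X (Y \<otimes>\<^bsub>idempotents\<^esub> Z) a (lax_mult fiber_functor Y Z b c)"
      if "X \<in> carrier idempotents" "Y \<in> carrier idempotents" "Z \<in> carrier idempotents"
        "a \<in> carrier (fob fiber_functor X)" "b \<in> carrier (fob fiber_functor Y)"
        "c \<in> carrier (fob fiber_functor Z)" for X Y Z a b c
      using that m_assoc[of a b c]
      by (simp add: lax_mult_fiber_functor[simplified] idem_mult_closed supp_mult)
    show "lax_mult fiber_functor \<one>\<^bsub>idempotents\<^esub> X (fun1 fiber_functor 1) a = a"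
      "lax_mult fiber_functor X \<one>\<^bsub>idempotents\<^esub> a (fun1 fiber_functor 1) = a"
      if "X \<in> carrier idempotents" "a \<in> carrier (fob fiber_functor X)" for X a
      using that by (simp_all add: lax_mult_fiber_functor[simplified] pow1 supp_idem)
  qed
qed

text \<open>In a pair \<open>(e, g)\<close> the index is forced to be \<open>supp g\<close>, so the
  second projection is bijective, with inverse sending \<open>x\<close> to
  \<open>(supp x, x)\<close>.\<close>

lemma assoc_semiring_fiber_functor_isomorphic:
  "semiring_isomorphic (assoc_semiring idempotents fiber_functor) R"
proof -
  let ?S = "assoc_semiring idempotents fiber_functor"
  have pow1: "\<one> [^]\<^bsub>fiber (supp \<one>)\<^esub> (1::int) = \<one>"
    by (rule group.int_pow_1[OF comm_group.axioms(2)[OF comm_group_fiber]]) (simp_all add: supp_idem)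
  interpret S: semiring ?S
    by (intro lax_monoidal.semiring_assoc_semiring lax_monoidalI idem_semiring_idempotents
        lax_monoidal_fiber_functor)
  have "restrict snd (carrier ?S) \<in> semiring_homs ?S R"
  proof (rule semiring_homsI)
    show "restrict snd (carrier ?S) \<one>\<^bsub>?S\<^esub> = \<one>" by (simp add: pow1 supp_idem)
    show "restrict snd (carrier ?S) \<zero>\<^bsub>?S\<^esub> = \<zero>" by (simp add: supp_of_idem)
    show "restrict snd (carrier ?S) x \<in> carrier R" if "x \<in> carrier ?S" for x
      using that by (auto elim!: assoc_semiring_cases)
    fix x y assume xy: "x \<in> carrier ?S" "y \<in> carrier ?S"
    obtain e g e' g' where [simp]: "x = (e, g)" "y = (e', g')" by (cases x, cases y) blast
    have c: "e \<in> carrier R" "e \<oplus> e = e" "e' \<in> carrier R" "e' \<oplus> e' = e'"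
      "g \<in> carrier R" "supp g = e" "g' \<in> carrier R" "supp g' = e'"
      using xy by simp_all
    show "restrict snd (carrier ?S) (x \<otimes>\<^bsub>?S\<^esub> y) =
        restrict snd (carrier ?S) x \<otimes> restrict snd (carrier ?S) y"
      using S.m_closed[OF xy] xy lax_mult_fiber_functor[OF c] by simp
    \<comment> \<open>Addition of pairs first adds \<open>e + e'\<close> to each entry; these
      idempotents are the supports of \<open>g\<close> and \<open>g'\<close> and are
      absorbed.\<close>
    have "g \<oplus> (e \<oplus> e') \<oplus> (g' \<oplus> (e \<oplus> e')) = (g \<oplus> e \<oplus> e) \<oplus> (g' \<oplus> e' \<oplus> e')"
      using c(1,3,5,7) by (simp add: a_ac)
    also have "\<dots> = g \<oplus> g'"
      using add_supp[OF c(5)] add_supp[OF c(7)] by (simp add: c(6,8))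
    finally show "restrict snd (carrier ?S) (x \<oplus>\<^bsub>?S\<^esub> y) =
        restrict snd (carrier ?S) x \<oplus> restrict snd (carrier ?S) y"
      using S.a_closed[OF xy] xy by simp
  qed simp
  moreover have "bij_betw (restrict snd (carrier ?S)) (carrier ?S) (carrier R)"
    by (rule bij_betwI[where g = "\<lambda>x. (supp x, x)"])
      (auto elim!: assoc_semiring_cases simp: supp_idem)
  ultimately show ?thesis unfolding semiring_isomorphic_def by blast
qed

end

section \<open>Assembly of the correspondence\<close>

lemma inverse_semiring_structI: "inverse_semiring R \<Longrightarrow> inverse_semiring_struct R"
  by (simp add: inverse_semiring_def comm_inverse_monoid_def inverse_semiring_struct_def
      inverse_semiring_struct_axioms_def)


theorem theorem8p5:
  shows
    "(\<forall>(Q :: 'q ring) (F :: ('q, 'a) lax_functor).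
        idem_semiring Q \<and> lax_monoidal_functor Q F \<longrightarrow> inverse_semiring (assoc_semiring Q F)) \<and>
     (\<forall>R :: 'r ring. inverse_semiring R \<longrightarrow>
        (\<exists>(Q :: 'r ring) (F :: ('r, 'r) lax_functor).
           idem_semiring Q \<and> lax_monoidal_functor Q F \<and>
           semiring_isomorphic (assoc_semiring Q F) R)) \<and>
     (\<forall>(Q :: 'q ring) (F :: ('q, 'a) lax_functor) (Q' :: 'q1 ring) (F' :: ('q1, 'a1) lax_functor).
        idem_semiring Q \<and> lax_monoidal_functor Q F \<and>
        idem_semiring Q' \<and> lax_monoidal_functor Q' F' \<longrightarrow>
          bij_betw (induced_map Q F) (pair_homs Q F Q' F')
            (semiring_homs (assoc_semiring Q F) (assoc_semiring Q' F')) \<and>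
          (\<forall>f\<in>semiring_homs Q Q'. \<forall>\<alpha>\<in>nat_transformations Q F (lax_precomp F' f).
             induced_map Q F (f, \<alpha>) \<in> semiring_homs (assoc_semiring Q F) (assoc_semiring Q' F') \<longleftrightarrow>
             monoidal_transformation Q F (lax_precomp F' f) \<alpha>) \<and>
          (semiring_isomorphic (assoc_semiring Q F) (assoc_semiring Q' F') \<longleftrightarrow>
           pair_isomorphic Q F Q' F')) \<and>
     (\<forall>(Q :: 'q ring) (F :: ('q, 'a) lax_functor).
        idem_semiring Q \<and> lax_monoidal_functor Q F \<longrightarrow>
          pair_id Q F \<in> pair_homs Q F Q F \<and>
          induced_map Q F (pair_id Q F) = (\<lambda>x\<in>carrier (assoc_semiring Q F). x)) \<and>
     (\<forall>(Q :: 'q ring) (F :: ('q, 'a) lax_functor) (Q' :: 'q1 ring) (F' :: ('q1, 'a1) lax_functor)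
        (Q'' :: 'q2 ring) (F'' :: ('q2, 'a2) lax_functor).
        idem_semiring Q \<and> lax_monoidal_functor Q F \<and>
        idem_semiring Q' \<and> lax_monoidal_functor Q' F' \<and>
        idem_semiring Q'' \<and> lax_monoidal_functor Q'' F'' \<longrightarrow>
          (\<forall>u\<in>pair_homs Q F Q' F'. \<forall>v\<in>pair_homs Q' F' Q'' F''.
             pair_comp Q F v u \<in> pair_homs Q F Q'' F'' \<and>
             induced_map Q F (pair_comp Q F v u) =
               compose (carrier (assoc_semiring Q F)) (induced_map Q' F' v) (induced_map Q F u)))"
proof (intro conjI allI impI, goal_cases)
  case (1 Q F)
  then show ?case
    by (intro lax_monoidal.inverse_semiring_assoc_semiring lax_monoidalI) auto
next
  case (2 R)
  then interpret inverse_semiring_struct R by (rule inverse_semiring_structI)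
  \<comment> \<open>Idempotents and fibres are subsets of the carrier of \<open>R\<close>, so both
    witnesses live on the element type of \<open>R\<close>.\<close>
  show ?case
    using idem_semiring_idempotents lax_monoidal_fiber_functor assoc_semiring_fiber_functor_isomorphic
    by blast
next
  case (3 Q F Q' F')
  then interpret lax_monoidal_pair Q F Q' F'
    by (intro lax_monoidal_pair.intro lax_monoidalI) auto
  show ?case by (rule bij_betw_induced_map)
next
  case (4 Q F Q' F')
  then interpret lax_monoidal_pair Q F Q' F'
    by (intro lax_monoidal_pair.intro lax_monoidalI) auto
  show ?case using induced_map_hom_iff by blast
next
  case (5 Q F Q' F')
  then interpret lax_monoidal_pair Q F Q' F'
    by (intro lax_monoidal_pair.intro lax_monoidalI) auto
  show ?case by (rule semiring_isomorphic_iff)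
next
  case (6 Q F)
  then show ?case by (intro lax_monoidal.pair_id_in_pair_homs lax_monoidalI) auto
next
  case (7 Q F)
  then show ?case by (intro lax_monoidal.induced_map_pair_id lax_monoidalI) auto
next
  case (8 Q F Q' F' Q'' F'')
  then have "lax_monoidal Q F" "lax_monoidal Q' F'" "lax_monoidal Q'' F''"
    by (auto intro: lax_monoidalI)
  then show ?case by (auto intro: pair_comp_in_pair_homs induced_map_pair_comp)
qed

end
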